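(* Let a retarded functional differential equation with initial data, a two-step Runge–Kutta method in its matrix form, its computed values $z^{[n]}$, the exact value functions $Z^{[n]}$, the global errors $q^{[n]}=Z^{[n]}-z^{[n]}$ and the local discretization error functions $h\,d^{[n]}$ be as described in the context. Assume that the method is zero-stable, and that the starting procedure $S$, which specifies the starting value $z^{[0]}=S(h,t_0,\phi_0)$, is such that $$|||q^{[0]}|||=O(h^{p-1}),\qquad \|q^{[0]}(0)\|=O(h^{p})\qquad\text{as } h\to0 .$$ If the method has uniform order of consistency $p-1$, that is, $$\max_{n=1,\dots,N}|||d^{[n]}|||=O(h^{p-1})\qquad\text{as } h\to 0,$$ and discrete order of consistency $p$, that is, $$\max_{n=1,\dots,N-1}\|d^{[n]}(0)\|=O(h^{p})\qquad\text{as } h\to 0,$$ then it has uniform order of convergence $p$, that is, $$\max_{n=1,\dots,N}|||q^{[n]}|||=O(h^p)\qquad\text{as }h\to0 .$$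
   Context: **Problem.** Let $r\ge 0$, let $\mathcal C=C([-r,0],\mathbb R^d)$ with $\|\varphi\|_{\mathcal C}=\max_{\theta\in[-r,0]}\|\varphi(\theta)\|_{\mathbb R^d}$, where $\|\cdot\|_{\mathbb R^d}$ is an arbitrary norm. For a function $u$ and a real $t$, $u_t(\theta)=u(t+\theta)$, $\theta\in[-r,0]$. Let $f:\mathbb R\times\mathcal C\to\mathbb R^d$ be continuous with a first derivative $f'$ with respect to the second argument that is bounded (as a map into $\mathcal L(\mathcal C,\mathbb R^d)$) and continuous with respect to the second argument. Let $\phi_0\in\mathcal C$ and let $y:[t_0-r,\bar t)\to\mathbb R^d$ be the unique non-continuable solution of $y'(t)=f(t,y_t)$ for $t\ge t_0$, $y_{t_0}=\phi_0$; let $t_0<T<\bar t$. The mesh is $t_n=t_0+nh$ with $h=(T-t_0)/N$; "$h\to0$" means $N\to\infty$. (Also $t_{-1}=t_0-h$.) Here $p$ is a positive integer. **Method.** Fix $s\ge1$ and coefficients: real $c_i\ge0$ ($i=1,\dots,s$); polynomial functions $u_i,\widetilde a_{ij},a_{ij}$ on $[0,c_i]$ and $v,\widetilde b_j,b_j$ on $[0,1]$ ($i,j=1,\dots,s$), with $u_i(0)=1$, $a_{ij}(0)=\widetilde a_{ij}(0)=0$, $v(0)=1$, $b_j(0)=\widetilde b_j(0)=0$. Put $c_{s+1}=1$, $u_{s+1}=v$, $\widetilde a_{s+1,j}=\widetilde b_j$, $a_{s+1,j}=b_j$, and let $\overline u_i(x)=u_i(x+c_i)$, $\overline{\widetilde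 a}_{ij}(x)=\widetilde a_{ij}(x+c_i)$, $\overline a_{ij}(x)=a_{ij}(x+c_i)$ for $x\in[-c_i,0]$, $i=1,\dots,s+1$, $j=1,\dots,s$. For $z=(z^1,\dots,z^{s+2})$ with components in $\mathbb R^d$, $\|z\|=\max_j\|z^j\|_{\mathbb R^d}$. For $\varphi=(\varphi^1,\dots,\varphi^{s+2}):[-r,0]\to\mathbb R^{(s+2)d}$ continuous, $|||\varphi|||=\max_{\theta\in[-r,0]}\|\varphi(\theta)\|$. Given $z^{[0]}$ (a continuous function $[-r,0]\to\mathbb R^{(s+2)d}$ with constant last component), the method computes for sufficiently small $h$ continuous functions $z^{[n]}=(z^{[n],1},\dots,z^{[n],s+2})$ on $[-r,0]$, $n=1,\dots,N$, satisfying, for $i=1,\dots,s+1$ and $\omega\in[-c_ih,0]$, $$z^{[n],i}(\omega)=\bigl(1-\overline u_i(\tfrac{\omega}{h})\bigr)z^{[n-1],s+2}+\overline u_i(\tfrac{\omega}{h})\,z^{[n-1],s+1}(0)+h\sum_{j=1}^s\overline{\widetilde a}_{ij}(\tfrac{\omega}{h})f\bigl(t_{n-2}+c_jh,z^{[n-1],j}\bigr)+h\sum_{j=1}^s\overline a_{ij}(\tfrac{\omega}{h})f\bigl(t_{n-1}+c_jh,z^{[n],j}\bigr);$$ for $\omega\in[-r,-c_ih]$, $z^{[n],i}(\omega)=z^{[n-1],s+1}(c_ih+\omega)$; and the last component is the constant $z^{[n],s+2}=z^{[n-1],s+1}(0)$. **Exact values and errors.** The exact value function is $$Z^{[n]}(\omega)=\bigl(y(t_n+(c_1-1)h+\omega),\dots,y(t_n+(c_s-1)h+\omega),\,y(t_n+\omega),\,y(t_{n-1})\bigr),\qquad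 \omega\in[-r,0],$$ $n=0,1,\dots,N$, where for $n=0$ a fixed continuous extension of $y$ to the left of $t_0-r$ is used where necessary. The global error is $q^{[n]}=Z^{[n]}-z^{[n]}$. The function $h\,d^{[n]}$ ($n\ge1$) is the residual obtained when $z^{[n-1]},z^{[n]}$ are replaced by $Z^{[n-1]},Z^{[n]}$ in the method: for $i=1,\dots,s+1$, $\omega\in[-c_ih,0]$, $h\,d^{[n],i}(\omega)$ is the left side minus the right side of the displayed formula after this replacement; $d^{[n],i}(\omega)=0$ for $\omega\in[-r,-c_ih]$; and $d^{[n],s+2}=0$. **Zero-stability.** Let $M(0)$ be the $(s+2)\times(s+2)$ matrix whose first $s$ columns are zero, whose $(s+1)$-st column is $(\overline u_1(0),\dots,\overline u_{s+1}(0),1)^T$ and whose last column is $(1-\overline u_1(0),\dots,1-\overline u_{s+1}(0),0)^T$. The method is zero-stable if there is $C>0$ with $\|M(0)^l\|\le C$ for all $l=1,2,\dots$.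
   Formalization: The formal theorem additionally assumes that component s+1 of the starting error q^{[0]} is O(h^p) uniformly on [-r,0]; without it the claim fails for r>0 (f=0, φ_0=0, z^{[0],s+1}=h^{p-1}g with g(0)=0, g≠0). *)

theory Defs
  imports
    "HOL-Analysis.Analysis"
    "HOL-Library.Landau_Symbols"
    "Jordan_Normal_Form.Matrix"
begin

definition is_norm :: "('v::real_vector \<Rightarrow> real) \<Rightarrow> bool" where
  "is_norm nrm \<longleftrightarrow>
     (\<forall>x. 0 \<le> nrm x) \<and> (\<forall>x. nrm x = 0 \<longleftrightarrow> x = 0) \<and>
     (\<forall>k x. nrm (k *\<^sub>R x) = \<bar>k\<bar> * nrm x) \<and> (\<forall>x y. nrm (x + y) \<le> nrm x + nrm y)"

text \<open>An element of C([-r,0], R^d) is represented by a function on all reals, of which only the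
  values on [-r,0] matter. The notions below use the sup norm over [-r,0] only, so that
  continuity of \<open>f\<close> and \<open>f'\<close> in the sense below already forces their values to depend on the
  restriction of the argument to [-r,0] alone.\<close>

definition Cspace :: "real \<Rightarrow> (real \<Rightarrow> 'v::topological_space) set" where
  "Cspace r = {\<phi>. continuous_on {-r..0} \<phi>}"

definition Cnorm :: "('v \<Rightarrow> real) \<Rightarrow> real \<Rightarrow> (real \<Rightarrow> 'v) \<Rightarrow> real" where
  "Cnorm nrm r \<phi> = (SUP \<theta>\<in>{-r..0}. nrm (\<phi> \<theta>))"

definition hist :: "(real \<Rightarrow> 'v) \<Rightarrow> real \<Rightarrow> real \<Rightarrow> 'v" where
  "hist u t = (\<lambda>\<theta>. u (t + \<theta>))"

definition continuous_rhs ::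
    "('v::real_normed_vector \<Rightarrow> real) \<Rightarrow> real \<Rightarrow> (real \<Rightarrow> (real \<Rightarrow> 'v) \<Rightarrow> 'v) \<Rightarrow> bool" where
  "continuous_rhs nrm r f \<longleftrightarrow>
     (\<forall>t. \<forall>\<phi>\<in>Cspace r. \<forall>\<epsilon>>0. \<exists>\<delta>>0. \<forall>t'. \<forall>\<psi>\<in>Cspace r.
        \<bar>t' - t\<bar> < \<delta> \<and> Cnorm nrm r (\<lambda>\<theta>. \<psi> \<theta> - \<phi> \<theta>) < \<delta> \<longrightarrow> nrm (f t' \<psi> - f t \<phi>) < \<epsilon>)"

definition linear_on_C ::
    "real \<Rightarrow> ((real \<Rightarrow> 'v::real_normed_vector) \<Rightarrow> 'v) \<Rightarrow> bool" where
  "linear_on_C r A \<longleftrightarrow>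
     (\<forall>\<phi>\<in>Cspace r. \<forall>\<psi>\<in>Cspace r. A (\<lambda>\<theta>. \<phi> \<theta> + \<psi> \<theta>) = A \<phi> + A \<psi>) \<and>
     (\<forall>k. \<forall>\<phi>\<in>Cspace r. A (\<lambda>\<theta>. k *\<^sub>R \<phi> \<theta>) = k *\<^sub>R A \<phi>)"

definition bounded_linear_on_C ::
    "('v::real_normed_vector \<Rightarrow> real) \<Rightarrow> real \<Rightarrow> ((real \<Rightarrow> 'v) \<Rightarrow> 'v) \<Rightarrow> bool" where
  "bounded_linear_on_C nrm r A \<longleftrightarrow>
     linear_on_C r A \<and> (\<exists>K. \<forall>\<phi>\<in>Cspace r. nrm (A \<phi>) \<le> K * Cnorm nrm r \<phi>)"

definition op_norm ::
    "('v::real_normed_vector \<Rightarrow> real) \<Rightarrow> real \<Rightarrow> ((real \<Rightarrow> 'v) \<Rightarrow> 'v) \<Rightarrow> real" where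
  "op_norm nrm r A = (SUP \<phi>\<in>{\<phi> \<in> Cspace r. Cnorm nrm r \<phi> \<le> 1}. nrm (A \<phi>))"

definition is_derivative_rhs ::
    "('v::real_normed_vector \<Rightarrow> real) \<Rightarrow> real \<Rightarrow> (real \<Rightarrow> (real \<Rightarrow> 'v) \<Rightarrow> 'v)
      \<Rightarrow> (real \<Rightarrow> (real \<Rightarrow> 'v) \<Rightarrow> (real \<Rightarrow> 'v) \<Rightarrow> 'v) \<Rightarrow> bool" where
  "is_derivative_rhs nrm r f f' \<longleftrightarrow>
     (\<forall>t. \<forall>\<phi>\<in>Cspace r. bounded_linear_on_C nrm r (f' t \<phi>) \<and>
        (\<forall>\<epsilon>>0. \<exists>\<delta>>0. \<forall>\<eta>\<in>Cspace r. Cnorm nrm r \<eta> < \<delta> \<longrightarrow>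
           nrm (f t (\<lambda>\<theta>. \<phi> \<theta> + \<eta> \<theta>) - f t \<phi> - f' t \<phi> \<eta>) \<le> \<epsilon> * Cnorm nrm r \<eta>))"

definition bounded_derivative ::
    "('v::real_normed_vector \<Rightarrow> real) \<Rightarrow> real
      \<Rightarrow> (real \<Rightarrow> (real \<Rightarrow> 'v) \<Rightarrow> (real \<Rightarrow> 'v) \<Rightarrow> 'v) \<Rightarrow> bool" where
  "bounded_derivative nrm r f' \<longleftrightarrow> (\<exists>L. \<forall>t. \<forall>\<phi>\<in>Cspace r. op_norm nrm r (f' t \<phi>) \<le> L)"

definition continuous_derivative ::
    "('v::real_normed_vector \<Rightarrow> real) \<Rightarrow> real
      \<Rightarrow> (real \<Rightarrow> (real \<Rightarrow> 'v) \<Rightarrow> (real \<Rightarrow> 'v) \<Rightarrow> 'v) \<Rightarrow> bool" where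
  "continuous_derivative nrm r f' \<longleftrightarrow>
     (\<forall>t. \<forall>\<phi>\<in>Cspace r. \<forall>\<epsilon>>0. \<exists>\<delta>>0. \<forall>\<psi>\<in>Cspace r.
        Cnorm nrm r (\<lambda>\<theta>. \<psi> \<theta> - \<phi> \<theta>) < \<delta> \<longrightarrow> op_norm nrm r (\<lambda>\<eta>. f' t \<psi> \<eta> - f' t \<phi> \<eta>) < \<epsilon>)"

text \<open>\<open>y\<close> solves the problem on [t0-r, b), where \<open>b\<close> may be infinite; the derivative at
  \<open>t0\<close> is the right-hand one.\<close>

definition rfde_solution ::
    "(real \<Rightarrow> (real \<Rightarrow> 'v::real_normed_vector) \<Rightarrow> 'v) \<Rightarrow> real \<Rightarrow> real \<Rightarrow> (real \<Rightarrow> 'v)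
      \<Rightarrow> (real \<Rightarrow> 'v) \<Rightarrow> ereal \<Rightarrow> bool" where
  "rfde_solution f r t0 \<phi>0 y b \<longleftrightarrow>
     ereal t0 < b \<and>
     continuous_on {t. t0 - r \<le> t \<and> ereal t < b} y \<and>
     (\<forall>\<theta>\<in>{-r..0}. y (t0 + \<theta>) = \<phi>0 \<theta>) \<and>
     (\<forall>t. t0 \<le> t \<and> ereal t < b \<longrightarrow>
        (y has_vector_derivative f t (hist y t)) (at t within {t0..}))"

definition rfde_noncontinuable ::
    "(real \<Rightarrow> (real \<Rightarrow> 'v::real_normed_vector) \<Rightarrow> 'v) \<Rightarrow> real \<Rightarrow> real \<Rightarrow> (real \<Rightarrow> 'v)
      \<Rightarrow> (real \<Rightarrow> 'v) \<Rightarrow> ereal \<Rightarrow> bool" where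
  "rfde_noncontinuable f r t0 \<phi>0 y b \<longleftrightarrow>
     rfde_solution f r t0 \<phi>0 y b \<and>
     \<not> (\<exists>y' b'. b < b' \<and> rfde_solution f r t0 \<phi>0 y' b' \<and>
            (\<forall>t. t0 - r \<le> t \<and> ereal t < b \<longrightarrow> y' t = y t))"

definition rfde_unique_noncontinuable ::
    "(real \<Rightarrow> (real \<Rightarrow> 'v::real_normed_vector) \<Rightarrow> 'v) \<Rightarrow> real \<Rightarrow> real \<Rightarrow> (real \<Rightarrow> 'v)
      \<Rightarrow> (real \<Rightarrow> 'v) \<Rightarrow> ereal \<Rightarrow> bool" where
  "rfde_unique_noncontinuable f r t0 \<phi>0 y b \<longleftrightarrow>
     rfde_noncontinuable f r t0 \<phi>0 y b \<and>
     (\<forall>y' b'. rfde_noncontinuable f r t0 \<phi>0 y' b' \<longrightarrow>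
        b' = b \<and> (\<forall>t. t0 - r \<le> t \<and> ereal t < b \<longrightarrow> y' t = y t))"

text \<open>Indices are those of the mathematics: stages \<open>i, j\<close> run through 1..s.
  \<open>co_at\<close>, \<open>co_bt\<close> are the coefficients with a tilde.\<close>

record tsrk =
  stages :: nat
  co_c :: "nat \<Rightarrow> real"
  co_u :: "nat \<Rightarrow> real poly"
  co_at :: "nat \<Rightarrow> nat \<Rightarrow> real poly"
  co_a :: "nat \<Rightarrow> nat \<Rightarrow> real poly"
  co_v :: "real poly"
  co_bt :: "nat \<Rightarrow> real poly"
  co_b :: "nat \<Rightarrow> real poly"

definition valid_tsrk :: "tsrk \<Rightarrow> bool" where
  "valid_tsrk M \<longleftrightarrow>
     1 \<le> stages M \<and>
     (\<forall>i\<in>{1..stages M}. 0 \<le> co_c M i \<and> poly (co_u M i) 0 = 1 \<and>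
        (\<forall>j\<in>{1..stages M}. poly (co_a M i j) 0 = 0 \<and> poly (co_at M i j) 0 = 0)) \<and>
     poly (co_v M) 0 = 1 \<and>
     (\<forall>j\<in>{1..stages M}. poly (co_b M j) 0 = 0 \<and> poly (co_bt M j) 0 = 0)"

definition cx :: "tsrk \<Rightarrow> nat \<Rightarrow> real" where
  "cx M i = (if i = stages M + 1 then 1 else co_c M i)"

definition ubar :: "tsrk \<Rightarrow> nat \<Rightarrow> real \<Rightarrow> real" where
  "ubar M i x = poly (if i = stages M + 1 then co_v M else co_u M i) (x + cx M i)"

definition atbar :: "tsrk \<Rightarrow> nat \<Rightarrow> nat \<Rightarrow> real \<Rightarrow> real" where
  "atbar M i j x = poly (if i = stages M + 1 then co_bt M j else co_at M i j) (x + cx M i)"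

definition abar :: "tsrk \<Rightarrow> nat \<Rightarrow> nat \<Rightarrow> real \<Rightarrow> real" where
  "abar M i j x = poly (if i = stages M + 1 then co_b M j else co_a M i j) (x + cx M i)"

text \<open>Functions [-r,0] to R^((s+2)d) are represented as \<open>z j \<omega>\<close> with the component index
  \<open>j\<close> in 1..s+2 first. The constant last component is evaluated at 0.\<close>

definition tsrk_rhs ::
    "tsrk \<Rightarrow> (real \<Rightarrow> (real \<Rightarrow> 'v::real_normed_vector) \<Rightarrow> 'v) \<Rightarrow> real \<Rightarrow> real \<Rightarrow> nat
      \<Rightarrow> (nat \<Rightarrow> real \<Rightarrow> 'v) \<Rightarrow> (nat \<Rightarrow> real \<Rightarrow> 'v) \<Rightarrow> nat \<Rightarrow> real \<Rightarrow> 'v" where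
  "tsrk_rhs M f t0 h n zprev z i \<omega> =
     (let s = stages M; t = (\<lambda>k::real. t0 + k * h) in
      (1 - ubar M i (\<omega> / h)) *\<^sub>R zprev (s + 2) 0
      + ubar M i (\<omega> / h) *\<^sub>R zprev (s + 1) 0
      + h *\<^sub>R (\<Sum>j = 1..s. atbar M i j (\<omega> / h) *\<^sub>R f (t (real n - 2) + co_c M j * h) (zprev j))
      + h *\<^sub>R (\<Sum>j = 1..s. abar M i j (\<omega> / h) *\<^sub>R f (t (real n - 1) + co_c M j * h) (z j)))"

text \<open>\<open>zprev\<close> has index n-1 and \<open>z\<close> has index n. Intersecting with [-r,0] matters only if
  c_i h > r, which for small h happens only when r = 0.\<close>

definition tsrk_step ::
    "tsrk \<Rightarrow> real \<Rightarrow> (real \<Rightarrow> (real \<Rightarrow> 'v::real_normed_vector) \<Rightarrow> 'v) \<Rightarrow> real \<Rightarrow> real \<Rightarrow> nat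
      \<Rightarrow> (nat \<Rightarrow> real \<Rightarrow> 'v) \<Rightarrow> (nat \<Rightarrow> real \<Rightarrow> 'v) \<Rightarrow> bool" where
  "tsrk_step M r f t0 h n zprev z \<longleftrightarrow>
     (let s = stages M in
      (\<forall>j\<in>{1..s+2}. continuous_on {-r..0} (z j)) \<and>
      (\<forall>i\<in>{1..s+1}. \<forall>\<omega>\<in>{-r..0}.
         (- cx M i * h \<le> \<omega> \<longrightarrow> z i \<omega> = tsrk_rhs M f t0 h n zprev z i \<omega>) \<and>
         (\<omega> \<le> - cx M i * h \<longrightarrow> z i \<omega> = zprev (s + 1) (cx M i * h + \<omega>))) \<and>
      (\<forall>\<omega>\<in>{-r..0}. z (s + 2) \<omega> = zprev (s + 1) 0))"

definition valid_start :: "tsrk \<Rightarrow> real \<Rightarrow> (nat \<Rightarrow> real \<Rightarrow> 'v::real_normed_vector) \<Rightarrow> bool" where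
  "valid_start M r z \<longleftrightarrow>
     (\<forall>j\<in>{1..stages M + 2}. continuous_on {-r..0} (z j)) \<and>
     (\<forall>\<omega>\<in>{-r..0}. z (stages M + 2) \<omega> = z (stages M + 2) 0)"

definition stepsize :: "real \<Rightarrow> real \<Rightarrow> nat \<Rightarrow> real" where
  "stepsize t0 T N = (T - t0) / real N"

definition exact_Z ::
    "tsrk \<Rightarrow> (real \<Rightarrow> 'v) \<Rightarrow> real \<Rightarrow> real \<Rightarrow> nat \<Rightarrow> nat \<Rightarrow> real \<Rightarrow> 'v" where
  "exact_Z M y t0 h n j \<omega> =
     (if j = stages M + 2 then y (t0 + (real n - 1) * h)
      else y (t0 + real n * h + (cx M j - 1) * h + \<omega>))"

definition global_error ::
    "tsrk \<Rightarrow> (real \<Rightarrow> 'v::real_normed_vector) \<Rightarrow> real \<Rightarrow> real \<Rightarrow> (nat \<Rightarrow> nat \<Rightarrow> real \<Rightarrow> 'v)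
      \<Rightarrow> nat \<Rightarrow> nat \<Rightarrow> real \<Rightarrow> 'v" where
  "global_error M y t0 h z n j \<omega> = exact_Z M y t0 h n j \<omega> - z n j \<omega>"

text \<open>\<open>local_d\<close> is d, so \<open>h *\<^sub>R local_d\<close> is the residual. On [-r, -c_i h] it is zero; at
  \<open>\<omega> = -c_i h\<close> both descriptions agree, since the residual vanishes there.\<close>

definition local_d ::
    "tsrk \<Rightarrow> (real \<Rightarrow> (real \<Rightarrow> 'v::real_normed_vector) \<Rightarrow> 'v) \<Rightarrow> (real \<Rightarrow> 'v) \<Rightarrow> real \<Rightarrow> real
      \<Rightarrow> nat \<Rightarrow> nat \<Rightarrow> real \<Rightarrow> 'v" where
  "local_d M f y t0 h n i \<omega> =
     (if i \<in> {1..stages M + 1} \<and> - cx M i * h \<le> \<omega>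
      then (1 / h) *\<^sub>R (exact_Z M y t0 h n i \<omega>
             - tsrk_rhs M f t0 h n (exact_Z M y t0 h (n - 1)) (exact_Z M y t0 h n) i \<omega>)
      else 0)"

definition vnorm :: "('v \<Rightarrow> real) \<Rightarrow> tsrk \<Rightarrow> (nat \<Rightarrow> 'v) \<Rightarrow> real" where
  "vnorm nrm M x = (MAX j\<in>{1..stages M + 2}. nrm (x j))"

definition tnorm :: "('v \<Rightarrow> real) \<Rightarrow> tsrk \<Rightarrow> real \<Rightarrow> (nat \<Rightarrow> real \<Rightarrow> 'v) \<Rightarrow> real" where
  "tnorm nrm M r \<phi> = (SUP \<theta>\<in>{-r..0}. vnorm nrm M (\<lambda>j. \<phi> j \<theta>))"

text \<open>Rows and columns of the library's matrices are numbered from 0.\<close>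

definition M0_mat :: "tsrk \<Rightarrow> real mat" where
  "M0_mat M =
     (let s = stages M in
      mat (s + 2) (s + 2) (\<lambda>(i, j).
        if j = s then (if i \<le> s then ubar M (i + 1) 0 else 1)
        else if j = s + 1 then (if i \<le> s then 1 - ubar M (i + 1) 0 else 0)
        else 0))"

text \<open>The matrix norm induced by the max norm.\<close>

definition mat_norm :: "real mat \<Rightarrow> real" where
  "mat_norm A = (MAX i\<in>{0..<dim_row A}. \<Sum>j = 0..<dim_col A. \<bar>A $$ (i, j)\<bar>)"

definition zero_stable :: "tsrk \<Rightarrow> bool" where
  "zero_stable M \<longleftrightarrow> (\<exists>C>0. \<forall>l\<ge>1. mat_norm (M0_mat M ^\<^sub>m l) \<le> C)"

end

theory Submission
  imports Defs
begin

text \<open>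
  Write \<open>q\<close> for the global error, \<open>Q n = |||q\<^sup>[\<^sup>n\<^sup>]|||\<close> for its uniform size, and let \<open>X n\<close> be the
  size of \<open>(q\<^sup>[\<^sup>n\<^sup>]\<^sup>,\<^sup>s\<^sup>+\<^sup>1(0), q\<^sup>[\<^sup>n\<^sup>]\<^sup>,\<^sup>s\<^sup>+\<^sup>2(0))\<close>, that is, of the errors at the mesh points \<open>t\<^sub>n\<close> and
  \<open>t\<^sub>n\<^sub>-\<^sub>1\<close>. Since the derivative of \<open>f\<close> is bounded, \<open>f\<close> is Lipschitz in its second argument
  (\<open>rhs_lipschitz\<close>).

  The nodal errors \<open>E\<^sub>n = q\<^sup>[\<^sup>n\<^sup>]\<^sup>,\<^sup>s\<^sup>+\<^sup>1(0)\<close> satisfy a two-term recursion with scalar coefficients,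
  \<open>E\<^sub>n = (1 - \<eta>) E\<^sub>n\<^sub>-\<^sub>2 + \<eta> E\<^sub>n\<^sub>-\<^sub>1 + g\<^sub>n\<close> with \<open>\<eta> = v(1)\<close>, where \<open>g\<^sub>n\<close> is \<open>h\<close> times the Lipschitz
  differences of \<open>f\<close> plus \<open>h d\<^sup>[\<^sup>n\<^sup>](0)\<close>. Its characteristic roots are \<open>1\<close> and \<open>\<eta> - 1\<close>, and
  boundedness of the powers of \<open>M(0)\<close> forces \<open>0 \<le> \<eta> < 2\<close> (\<open>zero_stable_root_condition\<close>); then
  the recursion sums its perturbations boundedly (\<open>two_term_stability\<close>). The nodal residuals are
  \<open>O(h\<^sup>p)\<close> except in the last step, where only \<open>O(h\<^sup>p\<^sup>-\<^sup>1)\<close> is known; but that residual, like the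
  uniform starting error \<open>Q 0 = O(h\<^sup>p\<^sup>-\<^sup>1)\<close>, enters once and with a factor \<open>h\<close>. Hence
  \<open>X n \<le> O(h\<^sup>p) + O(h) (Q 1 + ... + Q n)\<close> (\<open>nodal_error\<close>).

  On the whole delay interval, a component \<open>i \<le> s + 1\<close> of \<open>q\<^sup>[\<^sup>n\<^sup>]\<close> restricted to \<open>[-r, -c\<^sub>ih]\<close> is a
  shifted piece of \<open>q\<^sup>[\<^sup>n\<^sup>-\<^sup>1\<^sup>]\<^sup>,\<^sup>s\<^sup>+\<^sup>1\<close> (for \<open>n = 1\<close> this is \<open>O(h\<^sup>p)\<close> because the starting procedure
  approximates the initial function that well). On \<open>[-c\<^sub>ih, 0]\<close> it is bounded by a multiple of
  \<open>X (n - 1)\<close>, plus \<open>O(h) (Q (n - 1) + Q n)\<close>, plus \<open>h\<close> times a residual of size \<open>O(h\<^sup>p\<^sup>-\<^sup>1)\<close>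
  (\<open>uniform_error_step\<close>). The extra factor \<open>h\<close> is what turns uniform order of consistency \<open>p - 1\<close> into
  uniform order of convergence \<open>p\<close>. Combining both estimates, \<open>Q n \<le> O(h\<^sup>p) + O(h) (Q 1 + ... + Q n)\<close>
  for \<open>n \<ge> 1\<close>, and a discrete Gronwall inequality finishes the proof (\<open>error_recursion\<close>,
  \<open>uniform_error\<close>).
\<close>

section \<open>Norms on a Euclidean space\<close>

lemma is_norm_nonneg: "is_norm nrm \<Longrightarrow> 0 \<le> nrm x"
  by (simp add: is_norm_def)

lemma is_norm_zero: "is_norm nrm \<Longrightarrow> nrm 0 = 0"
  by (simp add: is_norm_def)

lemma is_norm_scaleR: "is_norm nrm \<Longrightarrow> nrm (k *\<^sub>R x) = \<bar>k\<bar> * nrm x"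
  by (simp add: is_norm_def)

lemma is_norm_triangle: "is_norm nrm \<Longrightarrow> nrm (x + y) \<le> nrm x + nrm y"
  by (simp add: is_norm_def)

lemma is_norm_triangle_le:
  "\<lbrakk>is_norm nrm; nrm x \<le> a; nrm y \<le> b\<rbrakk> \<Longrightarrow> nrm (x + y) \<le> a + b"
  by (meson add_mono is_norm_triangle order_trans)

lemma is_norm_minus: "is_norm nrm \<Longrightarrow> nrm (- x) = nrm x"
  using is_norm_scaleR[of nrm "-1" x] by simp

lemma is_norm_triangle_diff: "is_norm nrm \<Longrightarrow> nrm (x - y) \<le> nrm x + nrm y"
  using is_norm_triangle[of nrm x "- y"] is_norm_minus[of nrm y] by simp

lemma is_norm_sum: "is_norm nrm \<Longrightarrow> nrm (\<Sum>i\<in>I. g i) \<le> (\<Sum>i\<in>I. nrm (g i))"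
proof (induction I rule: infinite_finite_induct)
  case (insert x F)
  then show ?case
    using is_norm_triangle[of nrm "g x" "\<Sum>i\<in>F. g i"] by simp
qed (simp_all add: is_norm_zero)

lemma is_norm_le_norm:
  fixes nrm :: "'v::euclidean_space \<Rightarrow> real"
  assumes "is_norm nrm"
  obtains K where "0 < K" "\<And>x. nrm x \<le> K * norm x"
proof
  define K where "K = 1 + (\<Sum>b\<in>Basis. nrm b)"
  have K0: "0 \<le> (\<Sum>b\<in>Basis. nrm b)"
    by (intro sum_nonneg is_norm_nonneg assms)
  then show "0 < K" by (simp add: K_def)
  fix x :: 'v
  have "nrm x = nrm (\<Sum>b\<in>Basis. (x \<bullet> b) *\<^sub>R b)" by (simp add: euclidean_representation)
  also have "\<dots> \<le> (\<Sum>b\<in>Basis. nrm ((x \<bullet> b) *\<^sub>R b))" by (rule is_norm_sum[OF assms])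
  also have "\<dots> \<le> (\<Sum>b\<in>Basis. norm x * nrm b)"
    by (intro sum_mono)
       (simp add: is_norm_scaleR[OF assms] Basis_le_norm mult_right_mono is_norm_nonneg[OF assms])
  also have "\<dots> \<le> K * norm x" by (simp add: K_def sum_distrib_left algebra_simps)
  finally show "nrm x \<le> K * norm x" .
qed

lemma is_norm_continuous_on:
  fixes nrm :: "'v::euclidean_space \<Rightarrow> real"
  assumes nrm: "is_norm nrm"
  shows "continuous_on S nrm"
proof -
  obtain K where K: "0 < K" "\<And>x. nrm x \<le> K * norm x" using is_norm_le_norm[OF nrm] by blast
  have "dist (nrm x) (nrm y) \<le> K * dist x y" for x y
  proof -
    have "nrm x \<le> nrm (x - y) + nrm y" using is_norm_triangle[OF nrm, of "x - y" y] by simp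
    moreover have "nrm y \<le> nrm (x - y) + nrm x"
      using is_norm_triangle_diff[OF nrm, of x "x - y"] by simp
    ultimately show ?thesis using K(2)[of "x - y"] by (simp add: dist_norm)
  qed
  then have "K-lipschitz_on S nrm" using K(1) by (auto intro!: lipschitz_onI)
  then show ?thesis by (rule lipschitz_on_continuous_on)
qed

lemma norm_le_is_norm:
  fixes nrm :: "'v::euclidean_space \<Rightarrow> real"
  assumes nrm: "is_norm nrm"
  obtains K where "0 < K" "\<And>x. norm x \<le> K * nrm x"
proof -
  have "compact (sphere (0::'v) 1)" "sphere (0::'v) 1 \<noteq> {}" by simp_all
  then obtain x0 where x0: "x0 \<in> sphere (0::'v) 1" "\<And>x. x \<in> sphere 0 1 \<Longrightarrow> nrm x0 \<le> nrm x"
    using continuous_attains_inf[OF _ _ is_norm_continuous_on[OF nrm]] by metis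
  have pos: "0 < nrm x0"
    using x0(1) nrm is_norm_nonneg[OF nrm, of x0] by (auto simp: is_norm_def less_le)
  show thesis
  proof
    show "0 < 1 / nrm x0" using pos by simp
    fix x :: 'v
    show "norm x \<le> 1 / nrm x0 * nrm x"
    proof (cases "x = 0")
      case False
      have "nrm x0 \<le> nrm ((1 / norm x) *\<^sub>R x)" by (rule x0(2)) (use False in simp)
      then show ?thesis using False pos by (simp add: is_norm_scaleR[OF nrm] field_simps)
    qed (simp add: is_norm_zero[OF nrm])
  qed
qed

section \<open>Supremum norms\<close>

lemma Cspace_bdd:
  fixes nrm :: "'v::euclidean_space \<Rightarrow> real"
  assumes "is_norm nrm" "\<phi> \<in> Cspace r"
  shows "bdd_above ((\<lambda>\<theta>. nrm (\<phi> \<theta>)) ` {-r..0})"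
proof -
  have "continuous_on {-r..0} (\<lambda>\<theta>. nrm (\<phi> \<theta>))"
    using assms(2) continuous_on_compose2[OF is_norm_continuous_on[OF assms(1), of UNIV]]
    by (auto simp: Cspace_def)
  then have "compact ((\<lambda>\<theta>. nrm (\<phi> \<theta>)) ` {-r..0})"
    by (rule compact_continuous_image) simp
  then show ?thesis by (intro bounded_imp_bdd_above compact_imp_bounded)
qed

lemma le_Cnorm:
  fixes nrm :: "'v::euclidean_space \<Rightarrow> real"
  assumes "is_norm nrm" "\<phi> \<in> Cspace r" "\<theta> \<in> {-r..0}"
  shows "nrm (\<phi> \<theta>) \<le> Cnorm nrm r \<phi>"
  unfolding Cnorm_def by (rule cSUP_upper[OF assms(3) Cspace_bdd[OF assms(1,2)]])

lemma Cnorm_le: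
  assumes "0 \<le> r" "\<And>\<theta>. \<theta> \<in> {-r..0} \<Longrightarrow> nrm (\<phi> \<theta>) \<le> B"
  shows "Cnorm nrm r \<phi> \<le> B"
  unfolding Cnorm_def by (rule cSUP_least) (use assms in auto)

lemma Cnorm_nonneg:
  fixes nrm :: "'v::euclidean_space \<Rightarrow> real"
  assumes "is_norm nrm" "\<phi> \<in> Cspace r" "0 \<le> r"
  shows "0 \<le> Cnorm nrm r \<phi>"
  using le_Cnorm[OF assms(1,2), of 0] is_norm_nonneg[OF assms(1), of "\<phi> 0"] assms(3) by auto

lemma Cnorm_scaleR_le:
  fixes nrm :: "'v::euclidean_space \<Rightarrow> real"
  assumes "is_norm nrm" "\<phi> \<in> Cspace r" "0 \<le> r"
  shows "Cnorm nrm r (\<lambda>\<theta>. k *\<^sub>R \<phi> \<theta>) \<le> \<bar>k\<bar> * Cnorm nrm r \<phi>"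
  by (rule Cnorm_le[OF assms(3)])
     (simp add: is_norm_scaleR[OF assms(1)] mult_left_mono le_Cnorm[OF assms(1,2)])

lemma Cspace_add_scaleR:
  fixes \<phi> :: "real \<Rightarrow> 'v::real_normed_vector"
  shows "\<lbrakk>\<phi> \<in> Cspace r; \<psi> \<in> Cspace r\<rbrakk> \<Longrightarrow> (\<lambda>\<theta>. \<phi> \<theta> + k *\<^sub>R \<psi> \<theta>) \<in> Cspace r"
  by (auto simp: Cspace_def intro!: continuous_intros)

lemma Cspace_scaleR:
  fixes \<phi> :: "real \<Rightarrow> 'v::real_normed_vector"
  shows "\<phi> \<in> Cspace r \<Longrightarrow> (\<lambda>\<theta>. k *\<^sub>R \<phi> \<theta>) \<in> Cspace r"
  by (auto simp: Cspace_def intro!: continuous_intros)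

lemma Cspace_diff:
  fixes \<phi> :: "real \<Rightarrow> 'v::real_normed_vector"
  shows "\<lbrakk>\<phi> \<in> Cspace r; \<psi> \<in> Cspace r\<rbrakk> \<Longrightarrow> (\<lambda>\<theta>. \<phi> \<theta> - \<psi> \<theta>) \<in> Cspace r"
  by (auto simp: Cspace_def intro!: continuous_intros)

lemma le_vnorm:
  "j \<in> {1..stages M + 2} \<Longrightarrow> nrm (x j) \<le> vnorm nrm M x"
  unfolding vnorm_def by (rule Max_ge) auto

lemma vnorm_le:
  assumes "\<And>j. j \<in> {1..stages M + 2} \<Longrightarrow> nrm (x j) \<le> B"
  shows "vnorm nrm M x \<le> B"
  unfolding vnorm_def by (subst Max_le_iff) (use assms in auto)

lemma le_tnorm:
  assumes bdd: "\<And>j. j \<in> {1..stages M + 2} \<Longrightarrow> bdd_above ((\<lambda>\<theta>. nrm (\<phi> j \<theta>)) ` {-r..0})"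
    and j: "j \<in> {1..stages M + 2}" and \<theta>: "\<theta> \<in> {-r..0}"
  shows "nrm (\<phi> j \<theta>) \<le> tnorm nrm M r \<phi>"
proof -
  have "\<forall>j\<in>{1..stages M + 2}. \<exists>B. \<forall>\<theta>\<in>{-r..0}. nrm (\<phi> j \<theta>) \<le> B"
    using bdd by (auto simp: bdd_above_def)
  then obtain B where B: "\<And>j \<theta>. \<lbrakk>j \<in> {1..stages M + 2}; \<theta> \<in> {-r..0}\<rbrakk> \<Longrightarrow> nrm (\<phi> j \<theta>) \<le> B j"
    by metis
  have "bdd_above ((\<lambda>\<theta>. vnorm nrm M (\<lambda>j. \<phi> j \<theta>)) ` {-r..0})"
  proof (rule bdd_aboveI2)
    fix \<theta> assume "\<theta> \<in> {-r..0}"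
    show "vnorm nrm M (\<lambda>j. \<phi> j \<theta>) \<le> Max (B ` {1..stages M + 2})"
    proof (rule vnorm_le)
      fix j assume j: "j \<in> {1..stages M + 2}"
      have "B j \<le> Max (B ` {1..stages M + 2})" by (rule Max_ge) (use j in auto)
      then show "nrm (\<phi> j \<theta>) \<le> Max (B ` {1..stages M + 2})"
        using B[OF j \<open>\<theta> \<in> {-r..0}\<close>] by linarith
    qed
  qed
  then have "vnorm nrm M (\<lambda>j. \<phi> j \<theta>) \<le> tnorm nrm M r \<phi>"
    unfolding tnorm_def by (intro cSUP_upper \<theta>)
  then show ?thesis using le_vnorm[OF j, of nrm "\<lambda>j. \<phi> j \<theta>"] by linarith
qed

lemma tnorm_le:
  assumes "0 \<le> r"
    "\<And>j \<theta>. \<lbrakk>j \<in> {1..stages M + 2}; \<theta> \<in> {-r..0}\<rbrakk> \<Longrightarrow> nrm (\<phi> j \<theta>) \<le> B"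
  shows "tnorm nrm M r \<phi> \<le> B"
  unfolding tnorm_def by (rule cSUP_least) (use assms in \<open>auto intro!: vnorm_le\<close>)

section \<open>Lipschitz continuity of the right-hand side\<close>

text \<open>The mean value inequality along the segment from \<open>\<psi>\<close> to \<open>\<phi>\<close>. It is applied in the
  Euclidean norm, so passing to \<open>nrm\<close> and back costs a factor, which is immaterial here.\<close>

lemma rhs_lipschitz:
  fixes nrm :: "'v::euclidean_space \<Rightarrow> real"
  assumes nrm: "is_norm nrm" and r: "0 \<le> r"
    and f': "is_derivative_rhs nrm r f f'" and bdd: "bounded_derivative nrm r f'"
  obtains L where "0 \<le> L"
    "\<And>t \<phi> \<psi>. \<lbrakk>\<phi> \<in> Cspace r; \<psi> \<in> Cspace r\<rbrakk>
      \<Longrightarrow> nrm (f t \<phi> - f t \<psi>) \<le> L * Cnorm nrm r (\<lambda>\<theta>. \<phi> \<theta> - \<psi> \<theta>)"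
proof -
  obtain K1 where K1: "0 < K1" "\<And>x. nrm x \<le> K1 * norm x" using is_norm_le_norm[OF nrm] by blast
  obtain K2 where K2: "0 < K2" "\<And>x. norm x \<le> K2 * nrm x" using norm_le_is_norm[OF nrm] by blast
  obtain L0 where L0: "\<And>t \<phi>. \<phi> \<in> Cspace r \<Longrightarrow> op_norm nrm r (f' t \<phi>) \<le> L0"
    using bdd by (auto simp: bounded_derivative_def)
  define L where "L = \<bar>L0\<bar>"
  have lin: "linear_on_C r (f' t \<phi>)" if "\<phi> \<in> Cspace r" for t \<phi>
    using f' that by (auto simp: is_derivative_rhs_def bounded_linear_on_C_def)
  \<comment> \<open>\<open>op_norm\<close> is a supremum over the unit ball, hence an operator bound once the set is bounded above\<close>
  have op: "nrm (f' t \<phi> \<eta>) \<le> L * Cnorm nrm r \<eta>" if \<phi>: "\<phi> \<in> Cspace r" and \<eta>: "\<eta> \<in> Cspace r" for t \<phi> \<eta>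
  proof -
    obtain K where K: "\<And>\<phi>'. \<phi>' \<in> Cspace r \<Longrightarrow> nrm (f' t \<phi> \<phi>') \<le> K * Cnorm nrm r \<phi>'"
      using f' \<phi> unfolding is_derivative_rhs_def bounded_linear_on_C_def by meson
    show ?thesis
    proof (cases "Cnorm nrm r \<eta> = 0")
      case True
      then show ?thesis using K[OF \<eta>] by simp
    next
      case False
      define c where "c = Cnorm nrm r \<eta>"
      have c: "0 < c" using False Cnorm_nonneg[OF nrm \<eta> r] by (simp add: c_def)
      let ?\<eta> = "\<lambda>\<theta>. (1 / c) *\<^sub>R \<eta> \<theta>"
      have \<eta>': "?\<eta> \<in> Cspace r" by (rule Cspace_scaleR[OF \<eta>])
      have le1: "Cnorm nrm r ?\<eta> \<le> 1"
        using Cnorm_scaleR_le[OF nrm \<eta> r, of "1 / c"] c by (simp add: c_def)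
      have "bdd_above ((\<lambda>\<phi>'. nrm (f' t \<phi> \<phi>')) ` {\<phi>' \<in> Cspace r. Cnorm nrm r \<phi>' \<le> 1})"
      proof (rule bdd_aboveI2)
        fix \<phi>' assume "\<phi>' \<in> {\<phi>' \<in> Cspace r. Cnorm nrm r \<phi>' \<le> 1}"
        then have a: "\<phi>' \<in> Cspace r" "Cnorm nrm r \<phi>' \<le> 1" by auto
        have "K * Cnorm nrm r \<phi>' \<le> \<bar>K\<bar> * 1"
          using a Cnorm_nonneg[OF nrm a(1) r] by (intro mult_mono) auto
        then show "nrm (f' t \<phi> \<phi>') \<le> \<bar>K\<bar>" using K[OF a(1)] by simp
      qed
      then have "nrm (f' t \<phi> ?\<eta>) \<le> op_norm nrm r (f' t \<phi>)"
        unfolding op_norm_def by (intro cSUP_upper) (use \<eta>' le1 in auto)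
      also have "\<dots> \<le> L" using L0[OF \<phi>, of t] by (simp add: L_def)
      finally have "nrm (f' t \<phi> ?\<eta>) \<le> L" .
      moreover have "f' t \<phi> ?\<eta> = (1 / c) *\<^sub>R f' t \<phi> \<eta>"
        using lin[OF \<phi>, of t] \<eta> unfolding linear_on_C_def by blast
      ultimately show ?thesis using c by (simp add: is_norm_scaleR[OF nrm] field_simps c_def)
    qed
  qed
  show thesis
  proof
    show "0 \<le> K1 * (K2 * L)" using K1 K2 by (simp add: L_def)
    fix t and \<phi> \<psi> :: "real \<Rightarrow> 'v" assume \<phi>: "\<phi> \<in> Cspace r" and \<psi>: "\<psi> \<in> Cspace r"
    define \<eta> where "\<eta> = (\<lambda>\<theta>. \<phi> \<theta> - \<psi> \<theta>)"
    have \<eta>: "\<eta> \<in> Cspace r" unfolding \<eta>_def by (rule Cspace_diff[OF \<phi> \<psi>])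
    define c where "c = Cnorm nrm r \<eta>"
    have c: "0 \<le> c" using Cnorm_nonneg[OF nrm \<eta> r] by (simp add: c_def)
    \<comment> \<open>the segment from \<open>\<psi>\<close> to \<open>\<phi>\<close>\<close>
    define \<gamma> where "\<gamma> = (\<lambda>\<sigma> \<theta>. \<psi> \<theta> + \<sigma> *\<^sub>R \<eta> \<theta>)"
    have \<gamma>: "\<gamma> \<sigma> \<in> Cspace r" for \<sigma> unfolding \<gamma>_def by (rule Cspace_add_scaleR[OF \<psi> \<eta>])
    have deriv: "((\<lambda>\<sigma>. f t (\<gamma> \<sigma>)) has_derivative (\<lambda>k. k *\<^sub>R f' t (\<gamma> \<sigma>) \<eta>)) (at \<sigma> within {0..1})" for \<sigma>
      unfolding has_derivative_within_alt
    proof (intro conjI allI impI)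
      show "bounded_linear (\<lambda>k. k *\<^sub>R f' t (\<gamma> \<sigma>) \<eta>)"
        by (rule bounded_linear_scaleR_left)
      fix e :: real assume e: "0 < e"
      define e' where "e' = e / (K2 * (c + 1))"
      have e': "0 < e'" using e K2 c by (simp add: e'_def)
      obtain \<delta> where \<delta>: "0 < \<delta>" "\<And>\<zeta>. \<lbrakk>\<zeta> \<in> Cspace r; Cnorm nrm r \<zeta> < \<delta>\<rbrakk> \<Longrightarrow>
           nrm (f t (\<lambda>\<theta>. \<gamma> \<sigma> \<theta> + \<zeta> \<theta>) - f t (\<gamma> \<sigma>) - f' t (\<gamma> \<sigma>) \<zeta>) \<le> e' * Cnorm nrm r \<zeta>"
        using f' \<gamma> e' unfolding is_derivative_rhs_def by meson
      have main: "norm (f t (\<gamma> \<tau>) - f t (\<gamma> \<sigma>) - (\<tau> - \<sigma>) *\<^sub>R f' t (\<gamma> \<sigma>) \<eta>) \<le> e * norm (\<tau> - \<sigma>)"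
        if \<tau>: "norm (\<tau> - \<sigma>) < \<delta> / (c + 1)" for \<tau>
      proof -
        let ?\<zeta> = "\<lambda>\<theta>. (\<tau> - \<sigma>) *\<^sub>R \<eta> \<theta>"
        have \<zeta>: "?\<zeta> \<in> Cspace r" by (rule Cspace_scaleR[OF \<eta>])
        have le: "Cnorm nrm r ?\<zeta> \<le> \<bar>\<tau> - \<sigma>\<bar> * c"
          using Cnorm_scaleR_le[OF nrm \<eta> r] by (simp add: c_def)
        also have "\<dots> \<le> \<bar>\<tau> - \<sigma>\<bar> * (c + 1)" by (simp add: mult_left_mono)
        also have "\<dots> < \<delta>" using \<tau> c by (simp add: field_simps)
        finally have "Cnorm nrm r ?\<zeta> < \<delta>" .
        from \<delta>(2)[OF \<zeta> this] have
          "nrm (f t (\<lambda>\<theta>. \<gamma> \<sigma> \<theta> + ?\<zeta> \<theta>) - f t (\<gamma> \<sigma>) - f' t (\<gamma> \<sigma>) ?\<zeta>) \<le> e' * Cnorm nrm r ?\<zeta>" .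
        moreover have "(\<lambda>\<theta>. \<gamma> \<sigma> \<theta> + ?\<zeta> \<theta>) = \<gamma> \<tau>"
          by (simp add: \<gamma>_def fun_eq_iff algebra_simps)
        moreover have "f' t (\<gamma> \<sigma>) ?\<zeta> = (\<tau> - \<sigma>) *\<^sub>R f' t (\<gamma> \<sigma>) \<eta>"
          using lin[OF \<gamma>, of t \<sigma>] \<eta> unfolding linear_on_C_def by blast
        ultimately have "nrm (f t (\<gamma> \<tau>) - f t (\<gamma> \<sigma>) - (\<tau> - \<sigma>) *\<^sub>R f' t (\<gamma> \<sigma>) \<eta>)
            \<le> e' * Cnorm nrm r ?\<zeta>" by simp
        also have "\<dots> \<le> e' * (\<bar>\<tau> - \<sigma>\<bar> * (c + 1))"
          using le e' \<open>\<bar>\<tau> - \<sigma>\<bar> * c \<le> \<bar>\<tau> - \<sigma>\<bar> * (c + 1)\<close> by (intro mult_left_mono) auto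
        finally have "K2 * nrm (f t (\<gamma> \<tau>) - f t (\<gamma> \<sigma>) - (\<tau> - \<sigma>) *\<^sub>R f' t (\<gamma> \<sigma>) \<eta>)
            \<le> K2 * (e' * (\<bar>\<tau> - \<sigma>\<bar> * (c + 1)))" using K2(1) by simp
        also have "\<dots> = (e' * (K2 * (c + 1))) * \<bar>\<tau> - \<sigma>\<bar>" by (simp add: ac_simps)
        also have "e' * (K2 * (c + 1)) = e" using K2(1) c by (simp add: e'_def)
        finally show ?thesis using K2(2) order_trans by fastforce
      qed
      have "0 < \<delta> / (c + 1)" using \<delta>(1) c by simp
      with main show "\<exists>d>0. \<forall>\<tau>\<in>{0..1}. norm (\<tau> - \<sigma>) < d \<longrightarrow>
          norm (f t (\<gamma> \<tau>) - f t (\<gamma> \<sigma>) - (\<tau> - \<sigma>) *\<^sub>R f' t (\<gamma> \<sigma>) \<eta>) \<le> e * norm (\<tau> - \<sigma>)"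
        by blast
    qed
    have "norm (f t (\<gamma> 1) - f t (\<gamma> 0)) \<le> K2 * (L * c) * norm (1 - 0 :: real)"
    proof (rule differentiable_bound[of "{0..1}" _ "\<lambda>\<sigma> k. k *\<^sub>R f' t (\<gamma> \<sigma>) \<eta>"])
      show "onorm (\<lambda>k. k *\<^sub>R f' t (\<gamma> \<sigma>) \<eta>) \<le> K2 * (L * c)" for \<sigma>
      proof (rule onorm_le)
        fix k :: real
        have "norm (f' t (\<gamma> \<sigma>) \<eta>) \<le> K2 * nrm (f' t (\<gamma> \<sigma>) \<eta>)" by (rule K2(2))
        also have "\<dots> \<le> K2 * (L * c)" using op[OF \<gamma> \<eta>] K2(1) by (simp add: c_def)
        finally show "norm (k *\<^sub>R f' t (\<gamma> \<sigma>) \<eta>) \<le> K2 * (L * c) * norm k"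
          by (simp add: mult.commute mult_left_mono)
      qed
    qed (use deriv in auto)
    moreover have "\<gamma> 1 = \<phi>" "\<gamma> 0 = \<psi>" by (simp_all add: \<gamma>_def \<eta>_def)
    ultimately have le: "norm (f t \<phi> - f t \<psi>) \<le> K2 * (L * c)" by simp
    have "nrm (f t \<phi> - f t \<psi>) \<le> K1 * norm (f t \<phi> - f t \<psi>)" by (rule K1(2))
    also have "\<dots> \<le> K1 * (K2 * (L * c))" using le K1(1) by simp
    finally show "nrm (f t \<phi> - f t \<psi>) \<le> K1 * (K2 * L) * Cnorm nrm r (\<lambda>\<theta>. \<phi> \<theta> - \<psi> \<theta>)"
      by (simp add: c_def \<eta>_def mult.assoc)
  qed
qed

section \<open>Zero-stability\<close>

text \<open>The first \<open>s\<close> columns of \<open>M(0)\<close> vanish, so the last two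
  components of \<open>M(0)\<^sup>l x\<close> follow the two-term recursion
  \<open>e\<^sub>l\<^sub>+\<^sub>1 = \<eta> e\<^sub>l + (1 - \<eta>) e\<^sub>l\<^sub>-\<^sub>1\<close>, whose characteristic roots are \<open>1\<close> and \<open>\<eta> - 1\<close>.\<close>

lemma M0_pow_two_term:
  fixes e :: "nat \<Rightarrow> real"
  assumes rec: "\<And>l. e (Suc (Suc l)) =
      ubar M (stages M + 1) 0 * e (Suc l) + (1 - ubar M (stages M + 1) 0) * e l"
  defines "x \<equiv> vec (stages M + 2) (\<lambda>i. if i = stages M then e 1 else if i = stages M + 1 then e 0 else 0)"
  shows "((M0_mat M ^\<^sub>m l) *\<^sub>v x) $ (stages M + 1) = e l"
proof -
  define s where "s = stages M"
  let ?A = "M0_mat M"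
  have A: "?A \<in> carrier_mat (s + 2) (s + 2)" by (simp add: M0_mat_def Let_def s_def)
  have x: "x \<in> carrier_vec (s + 2)" by (simp add: x_def s_def)
  define w where "w l = (?A ^\<^sub>m l) *\<^sub>v x" for l
  have commute: "?A ^\<^sub>m Suc l = ?A * ?A ^\<^sub>m l" for l
  proof (induction l)
    case (Suc l)
    have "?A ^\<^sub>m Suc (Suc l) = (?A * ?A ^\<^sub>m l) * ?A" using Suc by simp
    also have "\<dots> = ?A * (?A ^\<^sub>m l * ?A)" using A by (intro assoc_mult_mat) auto
    finally show ?case by simp
  qed (use A in auto)
  have w_dim: "w l \<in> carrier_vec (s + 2)" for l
    unfolding w_def by (rule mult_mat_vec_carrier[OF pow_carrier_mat[OF A] x])
  have w_Suc: "w (Suc l) = ?A *\<^sub>v w l" for l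
    unfolding w_def commute by (rule assoc_mult_mat_vec[OF A pow_carrier_mat[OF A] x])
  have step: "w (Suc l) $ i = ?A $$ (i, s) * w l $ s + ?A $$ (i, s + 1) * w l $ (s + 1)"
    if i: "i < s + 2" for i l
  proof -
    have "w (Suc l) $ i = (\<Sum>j\<in>{0..<s + 2}. ?A $$ (i, j) * w l $ j)"
      using A w_dim[of l] i unfolding w_Suc by (auto simp: scalar_prod_def intro!: sum.cong)
    also have "\<dots> = (\<Sum>j\<in>{s, s + 1}. ?A $$ (i, j) * w l $ j)"
      by (rule sum.mono_neutral_right) (use i in \<open>auto simp: M0_mat_def Let_def s_def\<close>)
    finally show ?thesis by simp
  qed
  have "w l $ s = e (Suc l) \<and> w l $ (s + 1) = e l" for l
  proof (induction l)
    case 0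
    then show ?case using A x by (simp add: w_def x_def s_def)
  next
    case (Suc l)
    then show ?case
      using step[of s l] step[of "s + 1" l] rec[of l]
      by (simp add: M0_mat_def Let_def s_def)
  qed
  then show ?thesis by (simp add: w_def s_def)
qed

text \<open>Hence, under zero-stability, every solution of the recursion is bounded.\<close>

lemma zero_stable_bounded_two_term:
  fixes e :: "nat \<Rightarrow> real"
  assumes zs: "zero_stable M"
    and rec: "\<And>l. e (Suc (Suc l)) =
      ubar M (stages M + 1) 0 * e (Suc l) + (1 - ubar M (stages M + 1) 0) * e l"
  obtains B where "\<And>l. l \<ge> 1 \<Longrightarrow> \<bar>e l\<bar> \<le> B"
proof -
  define s where "s = stages M"
  let ?A = "M0_mat M"
  have A: "?A \<in> carrier_mat (s + 2) (s + 2)" by (simp add: M0_mat_def Let_def s_def)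
  obtain C where C: "C > 0" "\<And>l. l \<ge> 1 \<Longrightarrow> mat_norm (?A ^\<^sub>m l) \<le> C"
    using zs by (auto simp: zero_stable_def)
  define x where "x = vec (s + 2) (\<lambda>i. if i = s then e 1 else if i = s + 1 then e 0 else 0)"
  have dim_x: "dim_vec x = s + 2" by (simp add: x_def)
  define m where "m = \<bar>e 0\<bar> + \<bar>e 1\<bar>"
  show thesis
  proof
    fix l :: nat assume l: "l \<ge> 1"
    let ?P = "?A ^\<^sub>m l"
    have P: "?P \<in> carrier_mat (s + 2) (s + 2)" by (rule pow_carrier_mat[OF A])
    have "e l = (?P *\<^sub>v x) $ (s + 1)"
      unfolding x_def s_def by (rule M0_pow_two_term[of e M l, OF rec, symmetric])
    also have "\<dots> = row ?P (s + 1) \<bullet> x"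
      by (rule index_mult_mat_vec) (use carrier_matD[OF P] in simp)
    also have "\<dots> = (\<Sum>j = 0..<s + 2. ?P $$ (s + 1, j) * x $ j)"
      using carrier_matD[OF P] dim_x unfolding scalar_prod_def by (intro sum.cong) auto
    finally have "\<bar>e l\<bar> \<le> (\<Sum>j = 0..<s + 2. \<bar>?P $$ (s + 1, j) * x $ j\<bar>)" by (simp only: sum_abs)
    also have "\<dots> \<le> (\<Sum>j = 0..<s + 2. \<bar>?P $$ (s + 1, j)\<bar> * m)"
      by (intro sum_mono) (auto simp: abs_mult x_def m_def intro!: mult_left_mono)
    also have "\<dots> = (\<Sum>j = 0..<s + 2. \<bar>?P $$ (s + 1, j)\<bar>) * m" by (simp only: sum_distrib_right)
    also have "\<dots> \<le> C * m"
    proof (rule mult_right_mono)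
      have "(\<Sum>j = 0..<dim_col ?P. \<bar>?P $$ (s + 1, j)\<bar>) \<le> mat_norm ?P"
        unfolding mat_norm_def carrier_matD[OF P] by (rule Max_ge) auto
      also have "\<dots> \<le> C" by (rule C(2)[OF l])
      finally show "(\<Sum>j = 0..<s + 2. \<bar>?P $$ (s + 1, j)\<bar>) \<le> C" by (simp only: carrier_matD[OF P])
    qed (simp add: m_def)
    finally show "\<bar>e l\<bar> \<le> C * m" .
  qed
qed

lemma zero_stable_root_condition:
  assumes zs: "zero_stable M"
  shows "0 \<le> ubar M (stages M + 1) 0" "ubar M (stages M + 1) 0 < 2"
proof -
  define \<eta> where "\<eta> = ubar M (stages M + 1) 0"
  \<comment> \<open>powers of the characteristic root \<open>\<eta> - 1\<close> solve the recursion\<close>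
  obtain B where B: "\<And>l. l \<ge> 1 \<Longrightarrow> \<bar>(\<eta> - 1) ^ l\<bar> \<le> B"
    by (rule zero_stable_bounded_two_term[OF zs, of "\<lambda>l. (\<eta> - 1) ^ l"])
       (auto simp: \<eta>_def algebra_simps)
  have le: "\<bar>\<eta> - 1\<bar> \<le> 1"
  proof (rule ccontr)
    assume gt: "\<not> \<bar>\<eta> - 1\<bar> \<le> 1"
    then obtain n where n: "B < \<bar>\<eta> - 1\<bar> ^ n" using real_arch_pow[of "\<bar>\<eta> - 1\<bar>" B] by auto
    also have "\<dots> \<le> \<bar>\<eta> - 1\<bar> ^ Suc n" using gt by (intro power_increasing) auto
    also have "\<dots> \<le> B" using B[of "Suc n"] by (simp add: power_abs abs_mult)
    finally show False by simp
  qed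
  then show "0 \<le> ubar M (stages M + 1) 0" by (simp add: \<eta>_def)
  have "\<eta> \<noteq> 2"
  proof
    \<comment> \<open>\<open>1\<close> is then a double root, and \<open>l\<close> solves the recursion.\<close>
    assume 2: "\<eta> = 2"
    obtain B where B: "\<And>l. l \<ge> 1 \<Longrightarrow> \<bar>real l\<bar> \<le> B"
      by (rule zero_stable_bounded_two_term[OF zs, of real]) (use 2 in \<open>auto simp: \<eta>_def\<close>)
    obtain n where "B < real n" using reals_Archimedean2 by blast
    then show False using B[of "Suc n"] by simp
  qed
  then show "ubar M (stages M + 1) 0 < 2" using le by (simp add: \<eta>_def)
qed

text \<open>Stability of the inhomogeneous two-term recursion. With \<open>W = E + (1 - \<eta>) F\<close> and
  \<open>D = E - F\<close> it decouples into \<open>W\<^sub>n\<^sub>+\<^sub>1 = W\<^sub>n + g\<^sub>n\<^sub>+\<^sub>1\<close> and \<open>D\<^sub>n\<^sub>+\<^sub>1 = (\<eta> - 1) D\<^sub>n + g\<^sub>n\<^sub>+\<^sub>1\<close>, and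
  \<open>(2 - \<eta>) E = W + (1 - \<eta>) D\<close>, \<open>(2 - \<eta>) F = W - D\<close>.\<close>

lemma two_term_stability:
  fixes E F g :: "nat \<Rightarrow> 'v::real_normed_vector"
  assumes nrm: "is_norm nrm" and \<eta>: "0 \<le> \<eta>" "\<eta> < 2"
    and F: "\<And>n. n < N \<Longrightarrow> F (Suc n) = E n"
    and E: "\<And>n. n < N \<Longrightarrow> E (Suc n) = (1 - \<eta>) *\<^sub>R F n + \<eta> *\<^sub>R E n + g (Suc n)"
    and n: "n \<le> N"
  shows "max (nrm (E n)) (nrm (F n))
    \<le> 2 / (2 - \<eta>) * (nrm (E 0) + nrm (F 0) + (\<Sum>k = 1..n. nrm (g k)))"
proof -
  define W where "W n = E n + (1 - \<eta>) *\<^sub>R F n" for n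
  define D where "D n = E n - F n" for n
  define b where "b n = nrm (E 0) + nrm (F 0) + (\<Sum>k = 1..n. nrm (g k))" for n
  have small: "\<bar>1 - \<eta>\<bar> * nrm x \<le> nrm x" for x
    using \<eta> is_norm_nonneg[OF nrm, of x] by (intro mult_left_le_one_le) auto
  have WD: "nrm (W n) \<le> b n \<and> nrm (D n) \<le> b n" using n
  proof (induction n)
    case 0
    have "nrm (W 0) \<le> nrm (E 0) + \<bar>1 - \<eta>\<bar> * nrm (F 0)"
      using is_norm_triangle[OF nrm, of "E 0" "(1 - \<eta>) *\<^sub>R F 0"]
      by (simp add: W_def is_norm_scaleR[OF nrm])
    then show ?case
      using small[of "F 0"] is_norm_triangle_diff[OF nrm, of "E 0" "F 0"] by (simp add: b_def D_def)
  next
    case (Suc n)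
    have "W (Suc n) = W n + g (Suc n)"
      using Suc.prems F[of n] E[of n] by (simp add: W_def algebra_simps)
    then have 1: "nrm (W (Suc n)) \<le> nrm (W n) + nrm (g (Suc n))"
      using is_norm_triangle[OF nrm] by simp
    have "D (Suc n) = (\<eta> - 1) *\<^sub>R D n + g (Suc n)"
      using Suc.prems F[of n] E[of n] by (simp add: D_def algebra_simps)
    then have "nrm (D (Suc n)) \<le> \<bar>1 - \<eta>\<bar> * nrm (D n) + nrm (g (Suc n))"
      using is_norm_triangle[OF nrm, of "(\<eta> - 1) *\<^sub>R D n" "g (Suc n)"]
      by (simp add: is_norm_scaleR[OF nrm] abs_minus_commute)
    then have "nrm (D (Suc n)) \<le> nrm (D n) + nrm (g (Suc n))" using small[of "D n"] by linarith
    with 1 show ?case using Suc by (simp add: b_def)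
  qed
  have "(2 - \<eta>) *\<^sub>R E n = W n + (1 - \<eta>) *\<^sub>R D n" by (simp add: W_def D_def algebra_simps scaleR_2)
  then have "nrm ((2 - \<eta>) *\<^sub>R E n) \<le> nrm (W n) + \<bar>1 - \<eta>\<bar> * nrm (D n)"
    using is_norm_triangle[OF nrm, of "W n" "(1 - \<eta>) *\<^sub>R D n"] by (simp add: is_norm_scaleR[OF nrm])
  then have 1: "(2 - \<eta>) * nrm (E n) \<le> 2 * b n"
    using WD small[of "D n"] \<eta> by (simp add: is_norm_scaleR[OF nrm])
  have "(2 - \<eta>) *\<^sub>R F n = W n - D n" by (simp add: W_def D_def algebra_simps scaleR_2)
  then have "nrm ((2 - \<eta>) *\<^sub>R F n) \<le> nrm (W n) + nrm (D n)"
    using is_norm_triangle_diff[OF nrm, of "W n" "D n"] by simp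
  then have 2: "(2 - \<eta>) * nrm (F n) \<le> 2 * b n"
    using WD \<eta> by (simp add: is_norm_scaleR[OF nrm])
  show ?thesis using 1 2 \<eta> by (simp add: b_def field_simps)
qed

section \<open>Discrete Gronwall estimates\<close>

lemma discrete_gronwall:
  fixes Q :: "nat \<Rightarrow> real"
  assumes A: "0 \<le> A" and K: "0 \<le> K"
    and le: "\<And>n. \<lbrakk>1 \<le> n; n \<le> N\<rbrakk> \<Longrightarrow> Q n \<le> A + K * (\<Sum>k = 1..<n. Q k)"
    and n: "1 \<le> n" "n \<le> N"
  shows "Q n \<le> A * exp (K * real N)"
proof -
  have S: "A + K * (\<Sum>k = 1..<Suc m. Q k) \<le> A * (1 + K) ^ m" if "m \<le> N" for m
    using that
  proof (induction m)
    case (Suc m)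
    have "A + K * (\<Sum>k = 1..<Suc (Suc m). Q k) = A + K * (\<Sum>k = 1..<Suc m. Q k) + K * Q (Suc m)"
      by (simp add: algebra_simps)
    also have "\<dots> \<le> (1 + K) * (A + K * (\<Sum>k = 1..<Suc m. Q k))"
      using mult_left_mono[OF le[of "Suc m"] K] Suc.prems by (simp add: algebra_simps)
    also have "\<dots> \<le> (1 + K) * (A * (1 + K) ^ m)" using Suc K by (intro mult_left_mono) auto
    finally show ?case by (simp add: algebra_simps)
  qed simp
  obtain m where m: "n = Suc m" using n by (cases n) auto
  have "Q n \<le> A * (1 + K) ^ m" using le[OF n] S[of m] n m by simp
  also have "\<dots> \<le> A * exp (K * real N)"
  proof (rule mult_left_mono[OF _ A])
    have "(1 + K) ^ m \<le> exp K ^ m" using K by (intro power_mono exp_ge_add_one_self) auto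
    also have "\<dots> = exp (real m * K)" by (rule exp_of_nat_mult[symmetric])
    also have "\<dots> \<le> exp (K * real N)"
      using K n m mult_right_mono[of "real m" "real N" K] by (simp add: mult.commute)
    finally show "(1 + K) ^ m \<le> exp (K * real N)" .
  qed
  finally show ?thesis .
qed

text \<open>The scalar recursion satisfied by the uniform errors \<open>Q\<close> and the nodal errors \<open>X\<close>: on
  the part of the delay interval behind the last step the error is inherited from the previous
  step, and elsewhere it is bounded through \<open>X\<close>. The bound for the second part is nondecreasing
  in \<open>n\<close>, so the inherited part never dominates.\<close>

lemma error_recursion:
  fixes Q X :: "nat \<Rightarrow> real"
  assumes Q0: "\<And>n. n \<le> N \<Longrightarrow> 0 \<le> Q n" and a: "0 \<le> a" and \<beta>: "0 \<le> \<beta>" and \<kappa>: "0 \<le> \<kappa>"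
    and X: "\<And>n. n \<le> N \<Longrightarrow> X n \<le> a + \<kappa> * (\<Sum>k = 1..n. Q k)"
    and Q: "\<And>n. \<lbrakk>1 \<le> n; n \<le> N\<rbrakk> \<Longrightarrow>
      Q n \<le> max (if n = 1 then a else Q (n - 1))
                (a + \<beta> * X (n - 1) + \<kappa> * ((if n = 1 then 0 else Q (n - 1)) + Q n))"
    and small: "\<kappa> * (1 + \<beta>) \<le> 1 / 2"
    and n: "1 \<le> n" "n \<le> N"
  shows "Q n \<le> 2 * (1 + \<beta>) * a * exp (2 * \<kappa> * (1 + \<beta>) * real N)"
proof -
  define A where "A n = (1 + \<beta>) * (a + \<kappa> * (\<Sum>k = 1..n. Q k))" for n
  have A_mono: "A n \<le> A (Suc n)" if "Suc n \<le> N" for n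
    using that unfolding A_def using \<beta> \<kappa> Q0 by (intro mult_left_mono add_left_mono) auto
  have QA: "Q n \<le> A n" if "1 \<le> n" "n \<le> N" for n
    using that
  proof (induction n rule: nat_induct_at_least)
    case base
    have "X 0 \<le> a" using X[of 0] by simp
    then have "\<beta> * X 0 \<le> \<beta> * a" using \<beta> by (rule mult_left_mono)
    moreover have "\<kappa> * Q 1 \<le> (1 + \<beta>) * (\<kappa> * Q 1)"
      using base \<beta> \<kappa> Q0[of 1] mult_right_mono[of 1 "1 + \<beta>" "\<kappa> * Q 1"] by simp
    moreover have "a \<le> (1 + \<beta>) * a" "0 \<le> (1 + \<beta>) * (\<kappa> * Q 1)"
      using base \<beta> a \<kappa> Q0[of 1] by (auto simp: algebra_simps)
    ultimately show ?case using Q[of 1] base by (simp add: A_def algebra_simps)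
  next
    case (Suc n)
    have S: "(\<Sum>k = 1..Suc n. Q k) = (\<Sum>k = 1..n. Q k) + Q (Suc n)" by simp
    have "Q n \<le> (\<Sum>k = 1..n. Q k)"
      using Suc Q0 member_le_sum[of n "{1..n}" Q] by simp
    then have 1: "\<kappa> * (Q n + Q (Suc n)) \<le> \<kappa> * (\<Sum>k = 1..Suc n. Q k)"
      unfolding S using \<kappa> Suc by (intro mult_left_mono) auto
    have "(\<Sum>k = 1..n. Q k) \<le> (\<Sum>k = 1..Suc n. Q k)" using Q0[of "Suc n"] Suc.prems by simp
    then have "X n \<le> a + \<kappa> * (\<Sum>k = 1..Suc n. Q k)"
      using X[of n] Suc.prems mult_left_mono[OF _ \<kappa>] by (smt (verit) Suc_leD)
    then have "\<beta> * X n \<le> \<beta> * (a + \<kappa> * (\<Sum>k = 1..Suc n. Q k))" using \<beta> by (rule mult_left_mono)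
    with 1 have "a + \<beta> * X n + \<kappa> * (Q n + Q (Suc n)) \<le> A (Suc n)"
      unfolding A_def by (simp add: algebra_simps)
    moreover have "Q n \<le> A (Suc n)" using Suc A_mono[of n] by simp
    ultimately show ?case using Q[of "Suc n"] Suc by auto
  qed
  have "Q n \<le> 2 * (1 + \<beta>) * a + 2 * \<kappa> * (1 + \<beta>) * (\<Sum>k = 1..<n. Q k)" if n: "1 \<le> n" "n \<le> N" for n
  proof -
    have "(\<Sum>k = 1..n. Q k) = (\<Sum>k = 1..<n. Q k) + Q n"
      using n by (simp add: sum.last_plus)
    then have "Q n \<le> (1 + \<beta>) * a + \<kappa> * (1 + \<beta>) * (\<Sum>k = 1..<n. Q k) + \<kappa> * (1 + \<beta>) * Q n"
      using QA[OF n] by (simp add: A_def algebra_simps)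
    moreover have "\<kappa> * (1 + \<beta>) * Q n \<le> 1 / 2 * Q n" using small Q0[OF n(2)] by (rule mult_right_mono)
    ultimately show ?thesis by (simp add: algebra_simps)
  qed
  then show ?thesis by (rule discrete_gronwall[rotated 2]) (use a \<beta> \<kappa> n in auto)
qed

section \<open>Error propagation for a fixed step size\<close>

lemma coefficients_bounded:
  obtains B where "1 \<le> B"
    "\<And>i j x. \<lbrakk>i \<in> {1..stages M + 1}; j \<in> {1..stages M}; x \<in> {- cx M i..0}\<rbrakk> \<Longrightarrow>
      \<bar>1 - ubar M i x\<bar> \<le> B \<and> \<bar>ubar M i x\<bar> \<le> B \<and> \<bar>atbar M i j x\<bar> \<le> B \<and> \<bar>abar M i j x\<bar> \<le> B"
proof -
  let ?s = "stages M"
  let ?I = "{1..?s + 1} \<times> {1..?s}"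
  define g where "g = (\<lambda>(i, j) x.
    \<bar>1 - ubar M i x\<bar> + \<bar>ubar M i x\<bar> + \<bar>atbar M i j x\<bar> + \<bar>abar M i j x\<bar>)"
  have "\<exists>B. \<forall>x\<in>{- cx M (fst k)..0}. g k x \<le> B" for k
  proof -
    have "continuous_on {- cx M (fst k)..0} (g k)"
      unfolding g_def ubar_def atbar_def abar_def case_prod_unfold by (intro continuous_intros)
    then have "bdd_above (g k ` {- cx M (fst k)..0})"
      by (intro bounded_imp_bdd_above compact_imp_bounded compact_continuous_image) simp_all
    then show ?thesis by (auto simp: bdd_above_def)
  qed
  then obtain B where B: "\<And>k x. x \<in> {- cx M (fst k)..0} \<Longrightarrow> g k x \<le> B k" by metis
  \<comment> \<open>one constant for all coefficient functions: the sum over all index pairs\<close>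
  define B' where "B' = 1 + (\<Sum>k\<in>?I. \<bar>B k\<bar>)"
  show thesis
  proof
    show "1 \<le> B'" by (simp add: B'_def sum_nonneg)
    fix i j x assume *: "i \<in> {1..?s + 1}" "j \<in> {1..?s}" "x \<in> {- cx M i..0}"
    have "\<bar>B (i, j)\<bar> \<le> (\<Sum>k\<in>?I. \<bar>B k\<bar>)"
      by (rule member_le_sum[where f = "\<lambda>k. \<bar>B k\<bar>"]) (use * in auto)
    moreover have "g (i, j) x \<le> B (i, j)" by (rule B) (use * in simp)
    ultimately have "g (i, j) x \<le> B'" by (simp add: B'_def)
    then show "\<bar>1 - ubar M i x\<bar> \<le> B' \<and> \<bar>ubar M i x\<bar> \<le> B' \<and> \<bar>atbar M i j x\<bar> \<le> B' \<and> \<bar>abar M i j x\<bar> \<le> B'"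
      unfolding g_def by simp linarith
  qed
qed

lemma cx_nonneg: "\<lbrakk>valid_tsrk M; i \<in> {1..stages M + 1}\<rbrakk> \<Longrightarrow> 0 \<le> cx M i"
  by (auto simp: valid_tsrk_def cx_def)

text \<open>One run of the method with a fixed step size \<open>h\<close> over \<open>N\<close> steps, together with the constants
  that do not depend on \<open>h\<close>: \<open>L\<close> is a Lipschitz constant of \<open>f\<close> and \<open>B\<close> bounds the coefficient
  functions.\<close>

locale tsrk_run =
  fixes nrm :: "'v::euclidean_space \<Rightarrow> real" and r t0 h L B :: real
    and f :: "real \<Rightarrow> (real \<Rightarrow> 'v) \<Rightarrow> 'v" and y :: "real \<Rightarrow> 'v"
    and M :: tsrk and N :: nat and z :: "nat \<Rightarrow> nat \<Rightarrow> real \<Rightarrow> 'v"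
  assumes nrm: "is_norm nrm" and r: "0 \<le> r" and h: "0 < h" and valid: "valid_tsrk M"
    and L: "0 \<le> L"
    and lipschitz: "\<And>t \<phi> \<psi>. \<lbrakk>\<phi> \<in> Cspace r; \<psi> \<in> Cspace r\<rbrakk>
      \<Longrightarrow> nrm (f t \<phi> - f t \<psi>) \<le> L * Cnorm nrm r (\<lambda>\<theta>. \<phi> \<theta> - \<psi> \<theta>)"
    and B: "1 \<le> B"
    and coeff: "\<And>i j x. \<lbrakk>i \<in> {1..stages M + 1}; j \<in> {1..stages M}; x \<in> {- cx M i..0}\<rbrakk> \<Longrightarrow>
      \<bar>1 - ubar M i x\<bar> \<le> B \<and> \<bar>ubar M i x\<bar> \<le> B \<and> \<bar>atbar M i j x\<bar> \<le> B \<and> \<bar>abar M i j x\<bar> \<le> B"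
    and Z_cont: "\<And>n j. \<lbrakk>n \<le> N; j \<in> {1..stages M + 2}\<rbrakk> \<Longrightarrow> exact_Z M y t0 h n j \<in> Cspace r"
    and start: "valid_start M r (z 0)"
    and steps: "\<And>n. n \<in> {1..N} \<Longrightarrow> tsrk_step M r f t0 h n (z (n - 1)) (z n)"
begin

abbreviation "s \<equiv> stages M"
abbreviation "q \<equiv> global_error M y t0 h z"
abbreviation "d \<equiv> local_d M f y t0 h"

text \<open>Uniform size of the error and of the residual in step \<open>n\<close>.\<close>

abbreviation "Q n \<equiv> tnorm nrm M r (q n)"
abbreviation "D n \<equiv> tnorm nrm M r (d n)"

lemma s_pos: "1 \<le> s"
  using valid by (simp add: valid_tsrk_def)

lemma z_cont:
  assumes "n \<le> N" "j \<in> {1..s + 2}"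
  shows "z n j \<in> Cspace r"
proof (cases "n = 0")
  case True
  then show ?thesis using start assms by (auto simp: valid_start_def Cspace_def)
next
  case False
  then show ?thesis using steps[of n] assms by (auto simp: tsrk_step_def Cspace_def Let_def)
qed

lemma q_cont:
  assumes "n \<le> N" "j \<in> {1..s + 2}"
  shows "q n j \<in> Cspace r"
  using Cspace_diff[OF Z_cont[OF assms] z_cont[OF assms]] by (simp add: global_error_def[abs_def])

lemma le_Q:
  assumes "n \<le> N" "j \<in> {1..s + 2}" "\<theta> \<in> {-r..0}"
  shows "nrm (q n j \<theta>) \<le> Q n"
  by (rule le_tnorm) (use assms Cspace_bdd[OF nrm q_cont] in auto)

lemma Q_nonneg: "n \<le> N \<Longrightarrow> 0 \<le> Q n"
  using le_Q[of n 1 0] is_norm_nonneg[OF nrm, of "q n 1 0"] r by auto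

lemma Cnorm_q_le: "\<lbrakk>n \<le> N; j \<in> {1..s + 2}\<rbrakk> \<Longrightarrow> Cnorm nrm r (q n j) \<le> Q n"
  by (rule Cnorm_le[OF r]) (rule le_Q)

text \<open>The error at the two mesh points that a step uses.\<close>

definition X :: "nat \<Rightarrow> real" where
  "X n = max (nrm (q n (s + 1) 0)) (nrm (q n (s + 2) 0))"

text \<open>A Lipschitz constant of each of the two weighted sums of values of \<open>f\<close> in a step.\<close>

definition \<sigma> :: real where
  "\<sigma> = real s * B * L"

lemma X_nonneg: "0 \<le> X n"
  using is_norm_nonneg[OF nrm, of "q n (s + 1) 0"] by (simp add: X_def le_max_iff_disj)

lemma nrm_le_X: "nrm (q n (s + 1) 0) \<le> X n" "nrm (q n (s + 2) 0) \<le> X n"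
  by (simp_all add: X_def)

lemma \<sigma>_nonneg: "0 \<le> \<sigma>"
  using L B by (simp add: \<sigma>_def)

text \<open>Difference of the values of \<open>f\<close> at the exact and at the computed stage functions. In the
  step with index \<open>n\<close> it is needed for the indices \<open>n - 1\<close> and \<open>n\<close>, and
  the time argument depends on that index alone.\<close>

definition stage_defect :: "nat \<Rightarrow> nat \<Rightarrow> 'v" where
  "stage_defect n j =
     f (t0 + (real n - 1) * h + co_c M j * h) (exact_Z M y t0 h n j)
     - f (t0 + (real n - 1) * h + co_c M j * h) (z n j)"

lemma stage_defect_le:
  assumes "n \<le> N" "j \<in> {1..s}"
  shows "nrm (stage_defect n j) \<le> L * Q n"
proof -
  have "nrm (stage_defect n j) \<le> L * Cnorm nrm r (q n j)"
    unfolding stage_defect_def global_error_def[abs_def]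
    by (rule lipschitz) (use assms Z_cont z_cont in auto)
  also have "\<dots> \<le> L * Q n" using assms by (intro mult_left_mono[OF _ L] Cnorm_q_le) auto
  finally show ?thesis .
qed

lemma error_inherited:
  assumes n: "n \<in> {1..N}" and i: "i \<in> {1..s + 1}" and \<omega>: "\<omega> \<in> {-r..0}" "\<omega> \<le> - cx M i * h"
  shows "q n i \<omega> = q (n - 1) (s + 1) (cx M i * h + \<omega>)"
proof -
  have "z n i \<omega> = z (n - 1) (s + 1) (cx M i * h + \<omega>)"
    using steps[OF n] i \<omega> by (auto simp: tsrk_step_def Let_def)
  moreover have "exact_Z M y t0 h n i \<omega> = exact_Z M y t0 h (n - 1) (s + 1) (cx M i * h + \<omega>)"
  proof -
    have "t0 + real n * h + (cx M i - 1) * h + \<omega>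
        = t0 + real (n - 1) * h + (cx M (s + 1) - 1) * h + (cx M i * h + \<omega>)"
      using n by (simp add: of_nat_diff cx_def algebra_simps)
    then have "y (t0 + real n * h + (cx M i - 1) * h + \<omega>)
        = y (t0 + real (n - 1) * h + (cx M (s + 1) - 1) * h + (cx M i * h + \<omega>))"
      by (rule arg_cong)
    then show ?thesis using i by (simp add: exact_Z_def)
  qed
  ultimately show ?thesis by (simp add: global_error_def)
qed

lemma error_last:
  assumes n: "n \<in> {1..N}" and \<omega>: "\<omega> \<in> {-r..0}"
  shows "q n (s + 2) \<omega> = q (n - 1) (s + 1) 0"
proof -
  have "z n (s + 2) \<omega> = z (n - 1) (s + 1) 0"
    using steps[OF n] \<omega> by (auto simp: tsrk_step_def Let_def)
  then show ?thesis using n by (simp add: global_error_def exact_Z_def cx_def of_nat_diff)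
qed

text \<open>The contribution of \<open>f\<close> to the error in step \<open>n\<close>, divided by \<open>h\<close>.\<close>

definition increment :: "nat \<Rightarrow> nat \<Rightarrow> real \<Rightarrow> 'v" where
  "increment n i \<omega> =
     (\<Sum>j = 1..s. atbar M i j (\<omega> / h) *\<^sub>R stage_defect (n - 1) j)
     + (\<Sum>j = 1..s. abar M i j (\<omega> / h) *\<^sub>R stage_defect n j)"

text \<open>The error equation: subtracting the method from the equation defining the residual.\<close>

lemma error_equation:
  assumes n: "n \<in> {1..N}" and i: "i \<in> {1..s + 1}" and \<omega>: "\<omega> \<in> {-r..0}" "- cx M i * h \<le> \<omega>"
  shows "q n i \<omega> =
    ((1 - ubar M i (\<omega> / h)) *\<^sub>R q (n - 1) (s + 2) 0 + ubar M i (\<omega> / h) *\<^sub>R q (n - 1) (s + 1) 0)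
    + h *\<^sub>R (increment n i \<omega> + d n i \<omega>)"
proof -
  have z: "z n i \<omega> = tsrk_rhs M f t0 h n (z (n - 1)) (z n) i \<omega>"
    using steps[OF n] i \<omega> by (auto simp: tsrk_step_def Let_def)
  have Z: "exact_Z M y t0 h n i \<omega> =
      tsrk_rhs M f t0 h n (exact_Z M y t0 h (n - 1)) (exact_Z M y t0 h n) i \<omega> + h *\<^sub>R d n i \<omega>"
    using i \<omega> h by (simp add: local_d_def)
  have "real (n - 1) - 1 = real n - 2" using n by (auto simp: of_nat_diff)
  then show ?thesis
    unfolding global_error_def[of M y t0 h z n i \<omega>] z Z
    by (simp add: tsrk_rhs_def Let_def global_error_def stage_defect_def increment_def
        scaleR_diff_right sum_subtractf scaleR_add_right algebra_simps)
qed

lemma scaled_mem: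
  assumes "i \<in> {1..s + 1}" "\<omega> \<in> {-r..0}" "- cx M i * h \<le> \<omega>"
  shows "\<omega> / h \<in> {- cx M i..0}"
  using assms h by (auto simp: field_simps)

lemma propagated_le:
  assumes "i \<in> {1..s + 1}" "\<omega> \<in> {-r..0}" "- cx M i * h \<le> \<omega>"
  shows "nrm ((1 - ubar M i (\<omega> / h)) *\<^sub>R q n (s + 2) 0 + ubar M i (\<omega> / h) *\<^sub>R q n (s + 1) 0)
    \<le> 2 * B * X n"
proof -
  have u: "\<bar>1 - ubar M i (\<omega> / h)\<bar> \<le> B" "\<bar>ubar M i (\<omega> / h)\<bar> \<le> B"
    using coeff[OF assms(1) _ scaled_mem[OF assms], of 1] s_pos by auto
  have "\<bar>1 - ubar M i (\<omega> / h)\<bar> * nrm (q n (s + 2) 0) \<le> B * X n"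
    using u B by (intro mult_mono is_norm_nonneg[OF nrm] nrm_le_X) auto
  moreover have "\<bar>ubar M i (\<omega> / h)\<bar> * nrm (q n (s + 1) 0) \<le> B * X n"
    using u B by (intro mult_mono is_norm_nonneg[OF nrm] nrm_le_X) auto
  ultimately show ?thesis
    using is_norm_triangle[OF nrm, of "(1 - ubar M i (\<omega> / h)) *\<^sub>R q n (s + 2) 0" "ubar M i (\<omega> / h) *\<^sub>R q n (s + 1) 0"]
    by (simp add: is_norm_scaleR[OF nrm])
qed

lemma increment_le:
  assumes n: "n \<in> {1..N}" and i: "i \<in> {1..s + 1}" "\<omega> \<in> {-r..0}" "- cx M i * h \<le> \<omega>"
  shows "nrm (increment n i \<omega>) \<le> \<sigma> * (Q (n - 1) + Q n)"
proof -
  have c: "\<bar>atbar M i j (\<omega> / h)\<bar> \<le> B \<and> \<bar>abar M i j (\<omega> / h)\<bar> \<le> B" if "j \<in> {1..s}" for j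
    using coeff[OF i(1) that scaled_mem[OF i]] by simp
  have weighted: "nrm (\<Sum>j = 1..s. w j *\<^sub>R stage_defect m j) \<le> \<sigma> * Q m"
    if w: "\<And>j. j \<in> {1..s} \<Longrightarrow> \<bar>w j\<bar> \<le> B" and m: "m \<le> N" for w m
  proof -
    have "nrm (\<Sum>j = 1..s. w j *\<^sub>R stage_defect m j) \<le> (\<Sum>j = 1..s. nrm (w j *\<^sub>R stage_defect m j))"
      by (rule is_norm_sum[OF nrm])
    also have "\<dots> \<le> (\<Sum>j = 1..s. B * (L * Q m))"
      using w m B by (intro sum_mono)
        (auto simp: is_norm_scaleR[OF nrm] is_norm_nonneg[OF nrm] intro!: mult_mono stage_defect_le)
    finally show ?thesis by (simp add: \<sigma>_def mult.assoc)
  qed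
  show ?thesis
    unfolding increment_def distrib_left
    by (intro is_norm_triangle_le[OF nrm] weighted) (use c n in auto)
qed

text \<open>The supremum \<open>D n\<close> bounds the residual only if the residual is bounded on \<open>[-r, 0]\<close>; the error
  equation, solved for the residual, shows that it is.\<close>

lemma le_D:
  assumes n: "n \<in> {1..N}" and i: "i \<in> {1..s + 2}" and \<omega>: "\<omega> \<in> {-r..0}"
  shows "nrm (d n i \<omega>) \<le> D n"
proof (rule le_tnorm[OF _ i \<omega>])
  fix j assume j: "j \<in> {1..s + 2}"
  show "bdd_above ((\<lambda>\<omega>. nrm (d n j \<omega>)) ` {-r..0})"
  proof (rule bdd_aboveI2)
    fix \<omega> assume \<omega>: "\<omega> \<in> {-r..0}"
    let ?c = "(Q n + 2 * B * X (n - 1)) / h + \<sigma> * (Q (n - 1) + Q n)"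
    have nonneg: "0 \<le> ?c"
      using n Q_nonneg[of n] Q_nonneg[of "n - 1"] \<sigma>_nonneg X_nonneg[of "n - 1"] B h
      by (intro add_nonneg_nonneg mult_nonneg_nonneg divide_nonneg_pos) auto
    show "nrm (d n j \<omega>) \<le> ?c"
    proof (cases "j \<in> {1..s + 1} \<and> - cx M j * h \<le> \<omega>")
      case False
      then have "d n j \<omega> = 0" by (auto simp: local_d_def)
      then show ?thesis using nonneg by (simp only: is_norm_zero[OF nrm])
    next
      case True
      let ?e = "(1 - ubar M j (\<omega> / h)) *\<^sub>R q (n - 1) (s + 2) 0 + ubar M j (\<omega> / h) *\<^sub>R q (n - 1) (s + 1) 0"
      have "d n j \<omega> = (1 / h) *\<^sub>R (q n j \<omega> - ?e) - increment n j \<omega>"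
        using error_equation[OF n _ \<omega>] True h by simp
      then have "nrm (d n j \<omega>) \<le> nrm (q n j \<omega> - ?e) / h + nrm (increment n j \<omega>)"
        using is_norm_triangle_diff[OF nrm, of "(1 / h) *\<^sub>R (q n j \<omega> - ?e)" "increment n j \<omega>"] h
        by (simp add: is_norm_scaleR[OF nrm])
      also have "\<dots> \<le> ?c"
      proof (intro add_mono divide_right_mono)
        have "nrm (q n j \<omega> - ?e) \<le> nrm (q n j \<omega>) + nrm ?e" by (rule is_norm_triangle_diff[OF nrm])
        also have "\<dots> \<le> Q n + 2 * B * X (n - 1)"
          using n j \<omega> True by (intro add_mono le_Q propagated_le) auto
        finally show "nrm (q n j \<omega> - ?e) \<le> Q n + 2 * B * X (n - 1)" .
        show "nrm (increment n j \<omega>) \<le> \<sigma> * (Q (n - 1) + Q n)"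
          using True by (intro increment_le[OF n _ \<omega>]) auto
      qed (use h in simp)
      finally show ?thesis .
    qed
  qed
qed

text \<open>The first alternative covers the errors inherited from the previous step, including the last
  component; the second covers the part of the delay interval that the step computes.\<close>

lemma uniform_error_step:
  assumes n: "n \<in> {1..N}"
  shows "Q n \<le> max (Cnorm nrm r (q (n - 1) (s + 1)))
    (2 * B * X (n - 1) + h * (\<sigma> * (Q (n - 1) + Q n) + D n))" (is "_ \<le> max ?R ?F")
proof (rule tnorm_le[OF r])
  fix i \<omega> assume i: "i \<in> {1..s + 2}" and \<omega>: "\<omega> \<in> {-r..0}"
  have R: "nrm (q (n - 1) (s + 1) \<theta>) \<le> ?R" if "\<theta> \<in> {-r..0}" for \<theta>
    by (rule le_Cnorm[OF nrm q_cont that]) (use n in auto)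
  consider "i = s + 2" | "i \<in> {1..s + 1}" "\<omega> \<le> - cx M i * h" | "i \<in> {1..s + 1}" "- cx M i * h \<le> \<omega>"
    using i by fastforce
  then show "nrm (q n i \<omega>) \<le> max ?R ?F"
  proof cases
    case 1
    then show ?thesis using error_last[OF n \<omega>] R[of 0] r by auto
  next
    case 2
    have "0 \<le> cx M i * h" using cx_nonneg[OF valid 2(1)] h by simp
    then have "cx M i * h + \<omega> \<in> {-r..0}" using 2 \<omega> by auto
    then show ?thesis using error_inherited[OF n 2(1) \<omega> 2(2)] R by (simp add: le_max_iff_disj)
  next
    case 3
    have "nrm (h *\<^sub>R (increment n i \<omega> + d n i \<omega>)) \<le> h * (\<sigma> * (Q (n - 1) + Q n) + D n)"
      using h is_norm_triangle_le[OF nrm increment_le[OF n 3(1) \<omega> 3(2)] le_D[OF n i \<omega>]]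
      by (simp add: is_norm_scaleR[OF nrm])
    then have "nrm (q n i \<omega>) \<le> ?F"
      unfolding error_equation[OF n 3(1) \<omega> 3(2)]
      by (intro is_norm_triangle_le[OF nrm] propagated_le[OF 3(1) \<omega> 3(2)])
    then show ?thesis by (rule max.coboundedI2)
  qed
qed

lemma nodal_error:
  assumes zs: "zero_stable M" and n: "n \<le> N"
  shows "X n \<le> 2 / (2 - ubar M (s + 1) 0) *
    (2 * X 0 + (\<Sum>k = 1..n. h * (\<sigma> * (Q (k - 1) + Q k) + nrm (d k (s + 1) 0))))"
proof -
  define \<eta> where "\<eta> = ubar M (s + 1) 0"
  have \<eta>: "0 \<le> \<eta>" "\<eta> < 2" using zero_stable_root_condition[OF zs] by (simp_all add: \<eta>_def)
  define g where "g k = h *\<^sub>R (increment k (s + 1) 0 + d k (s + 1) 0)" for k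
  have cx: "- cx M (s + 1) * h \<le> 0" using h by (simp add: cx_def)
  have "max (nrm (q n (s + 1) 0)) (nrm (q n (s + 2) 0)) \<le> 2 / (2 - \<eta>) * (nrm (q 0 (s + 1) 0) + nrm (q 0 (s + 2) 0) + (\<Sum>k = 1..n. nrm (g k)))"
  proof (rule two_term_stability[OF nrm \<eta> _ _ n])
    fix m assume m: "m < N"
    show "q (Suc m) (s + 2) 0 = q m (s + 1) 0" using error_last[of "Suc m" 0] m r by simp
    show "q (Suc m) (s + 1) 0 = (1 - \<eta>) *\<^sub>R q m (s + 2) 0 + \<eta> *\<^sub>R q m (s + 1) 0 + g (Suc m)"
      using error_equation[of "Suc m" "s + 1" 0, OF _ _ _ cx] m r by (simp add: g_def \<eta>_def)
  qed
  also have "\<dots> \<le> 2 / (2 - \<eta>) *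
      (2 * X 0 + (\<Sum>k = 1..n. h * (\<sigma> * (Q (k - 1) + Q k) + nrm (d k (s + 1) 0))))"
  proof (intro mult_left_mono add_mono sum_mono)
    show "nrm (q 0 (s + 1) 0) + nrm (q 0 (s + 2) 0) \<le> 2 * X 0"
      using nrm_le_X[of 0] by linarith
    fix k assume k: "k \<in> {1..n}"
    have "nrm (increment k (s + 1) 0 + d k (s + 1) 0) \<le> \<sigma> * (Q (k - 1) + Q k) + nrm (d k (s + 1) 0)"
      using k n r cx by (intro is_norm_triangle_le[OF nrm] increment_le) auto
    then show "nrm (g k) \<le> h * (\<sigma> * (Q (k - 1) + Q k) + nrm (d k (s + 1) 0))"
      using h by (simp add: g_def is_norm_scaleR[OF nrm])
  qed (use \<eta> in simp)
  finally show ?thesis unfolding X_def[of n] by (simp add: \<eta>_def)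
qed

text \<open>All data errors are measured in units of \<open>P\<close>, which will be \<open>h ^ p\<close>. The uniform starting
  error \<open>Q 0\<close> and the uniform residuals \<open>D n\<close> are only of order \<open>P / h\<close>, but they always carry a
  factor \<open>h\<close> and are never summed over the steps: \<open>Q 0\<close> and \<open>D N\<close> enter the nodal recursion once, and
  \<open>D n\<close> enters the bound for \<open>Q n\<close> directly.\<close>

lemma uniform_error:
  assumes zs: "zero_stable M" and P: "0 \<le> P" and C: "0 \<le> C" and l: "real N * h = l"
    and start_history: "Cnorm nrm r (q 0 (s + 1)) \<le> C * P"
    and start_nodal: "X 0 \<le> C * P"
    and start_uniform: "h * Q 0 \<le> C * P"
    and d_uniform: "\<And>n. n \<in> {1..N} \<Longrightarrow> h * D n \<le> C * P"
    and d_nodal: "\<And>n. n \<in> {1..N - 1} \<Longrightarrow> nrm (d n (s + 1) 0) \<le> C * P"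
  defines "K \<equiv> 2 / (2 - ubar M (s + 1) 0)"
  defines "\<kappa> \<equiv> \<sigma> * (1 + 2 * K)"
  assumes small: "h * \<kappa> * (1 + 2 * B) \<le> 1 / 2"
    and n: "n \<in> {1..N}"
  shows "Q n \<le> (2 * (1 + 2 * B) * ((K * (3 + \<sigma> + l) + 1 + \<sigma>) * C) * exp (2 * \<kappa> * (1 + 2 * B) * l)) * P"
proof -
  have K: "0 \<le> K" using zero_stable_root_condition[OF zs] by (simp add: K_def)
  have l0: "0 \<le> l" using h l by auto
  define a where "a = (K * (3 + \<sigma> + l) + 1 + \<sigma>) * C * P"
  have CP: "0 \<le> C * P" using C P by simp
  have a0: "0 \<le> a" unfolding a_def using K \<sigma>_nonneg l0 C P by (intro mult_nonneg_nonneg add_nonneg_nonneg) auto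
  have aCP: "(1 + \<sigma>) * (C * P) \<le> a" "C * P \<le> a"
  proof -
    have "0 \<le> K * (3 + \<sigma> + l)" using K \<sigma>_nonneg l0 by simp
    then have "0 \<le> K * (3 + \<sigma> + l) * (C * P)" "0 \<le> \<sigma> * (C * P)"
      using CP \<sigma>_nonneg by (simp_all only: mult_nonneg_nonneg)
    then show "(1 + \<sigma>) * (C * P) \<le> a" "C * P \<le> a" by (simp_all add: a_def algebra_simps)
  qed
  have start_\<sigma>: "h * (\<sigma> * Q 0) \<le> \<sigma> * (C * P)"
    using mult_left_mono[OF start_uniform \<sigma>_nonneg] by (simp add: algebra_simps)
  have "Q n \<le> 2 * (1 + 2 * B) * a * exp (2 * (h * \<kappa>) * (1 + 2 * B) * real N)"
  proof (rule error_recursion[where X = X])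
    show "0 \<le> h * \<kappa>" using h K \<sigma>_nonneg unfolding \<kappa>_def by (intro mult_nonneg_nonneg) auto
    show "0 \<le> 2 * B" using B by simp
    fix n assume n: "n \<le> N"
    show "0 \<le> Q n" by (rule Q_nonneg[OF n])
    have SQ: "0 \<le> (\<Sum>k = 1..n. Q k)" using n Q_nonneg by (intro sum_nonneg) auto
    have "(\<Sum>k = 1..n. Q (k - 1)) \<le> Q 0 + (\<Sum>k = 1..n. Q k)"
    proof (cases n)
      case 0
      then show ?thesis using Q_nonneg[of 0] by simp
    next
      case (Suc m)
      have "(\<Sum>k = 1..Suc m. Q (k - 1)) = (\<Sum>k = 0..m. Q k)"
        using sum.shift_bounds_cl_Suc_ivl[of "\<lambda>k. Q (k - 1)" 0 m] by simp
      also have "\<dots> = Q 0 + (\<Sum>k = 1..m. Q k)" by (simp add: sum.atLeast_Suc_atMost)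
      finally show ?thesis using Suc Q_nonneg[of "Suc m"] n by simp
    qed
    then have S1: "h * \<sigma> * (\<Sum>k = 1..n. Q (k - 1) + Q k) \<le> h * \<sigma> * (Q 0 + 2 * (\<Sum>k = 1..n. Q k))"
      using h \<sigma>_nonneg by (intro mult_left_mono) (auto simp: sum.distrib)
    have S2: "(\<Sum>k = 1..n. h * nrm (d k (s + 1) 0)) \<le> (l + 1) * (C * P)"
    proof -
      have "(\<Sum>k = 1..n. h * nrm (d k (s + 1) 0)) \<le> (\<Sum>k = 1..N. h * nrm (d k (s + 1) 0))"
        using n h by (intro sum_mono2) (auto simp: is_norm_nonneg[OF nrm])
      also have "\<dots> \<le> (\<Sum>k = 1..N. h * (C * P) + (if k = N then C * P else 0))"
      proof (rule sum_mono)
        fix k assume k: "k \<in> {1..N}"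
        show "h * nrm (d k (s + 1) 0) \<le> h * (C * P) + (if k = N then C * P else 0)"
        proof (cases "k = N")
          case True
          \<comment> \<open>the sharper nodal bound is not assumed for the last step\<close>
          have "h * nrm (d k (s + 1) 0) \<le> h * D k"
            using h k r by (intro mult_left_mono le_D) auto
          then show ?thesis
            unfolding if_P[OF True] using d_uniform[OF k] mult_nonneg_nonneg[OF _ CP, of h] h by linarith
        next
          case False
          then have "k \<in> {1..N - 1}" using k by auto
          then show ?thesis using d_nodal[of k] False h by simp
        qed
      qed
      also have "\<dots> \<le> (l + 1) * (C * P)"
        using CP l by (auto simp: sum.distrib algebra_simps)
      finally show ?thesis .
    qed
    have "X n \<le> K * (2 * X 0 + (h * \<sigma> * (\<Sum>k = 1..n. Q (k - 1) + Q k) + (\<Sum>k = 1..n. h * nrm (d k (s + 1) 0))))"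
      using nodal_error[OF zs n]
      by (simp add: K_def distrib_left sum.distrib sum_distrib_left mult.assoc)
    also have "\<dots> \<le> K * (2 * (C * P) + ((\<sigma> * (C * P) + 2 * h * \<sigma> * (\<Sum>k = 1..n. Q k)) + (l + 1) * (C * P)))"
      using S1 S2 start_\<sigma> start_nodal by (intro mult_left_mono[OF _ K] add_mono) (auto simp: algebra_simps)
    also have "\<dots> \<le> a + h * \<kappa> * (\<Sum>k = 1..n. Q k)"
    proof -
      have "0 \<le> (1 + \<sigma>) * (C * P)" "0 \<le> h * \<sigma> * (\<Sum>k = 1..n. Q k)"
        using \<sigma>_nonneg h mult_nonneg_nonneg[OF _ CP, of "1 + \<sigma>"] mult_nonneg_nonneg[OF _ SQ, of "h * \<sigma>"]
        by simp_all
      then show ?thesis by (simp add: a_def \<kappa>_def algebra_simps)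
    qed
    finally show "X n \<le> a + h * \<kappa> * (\<Sum>k = 1..n. Q k)" .
  next
    fix n assume n: "1 \<le> n" "n \<le> N"
    let ?Q' = "if n = 1 then 0 else Q (n - 1)"
    have "Cnorm nrm r (q (n - 1) (s + 1)) \<le> (if n = 1 then a else Q (n - 1))"
      using Cnorm_q_le[of "n - 1" "s + 1"] start_history aCP n by auto
    moreover have "2 * B * X (n - 1) + h * (\<sigma> * (Q (n - 1) + Q n) + D n)
        \<le> a + 2 * B * X (n - 1) + h * \<kappa> * (?Q' + Q n)"
    proof -
      have "h * (\<sigma> * (Q (n - 1) + Q n)) \<le> \<sigma> * (C * P) + h * \<sigma> * (?Q' + Q n)"
        using start_\<sigma> \<sigma>_nonneg CP mult_nonneg_nonneg[OF \<sigma>_nonneg CP] by (auto simp: algebra_simps)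
      moreover have "h * \<sigma> * (?Q' + Q n) \<le> h * \<kappa> * (?Q' + Q n)"
        using h K \<sigma>_nonneg Q_nonneg[of n] Q_nonneg[of "n - 1"] n mult_nonneg_nonneg[OF \<sigma>_nonneg K]
        unfolding \<kappa>_def by (intro mult_right_mono mult_left_mono) (auto simp: algebra_simps)
      moreover have "h * D n \<le> C * P" using d_uniform n by simp
      ultimately show ?thesis using aCP by (simp add: algebra_simps)
    qed
    ultimately show "Q n \<le> max (if n = 1 then a else Q (n - 1))
        (a + 2 * B * X (n - 1) + h * \<kappa> * (?Q' + Q n))"
      using order_trans[OF uniform_error_step[of n] max.mono] n by simp
  qed (use a0 small n in auto)
  also have "2 * (h * \<kappa>) * (1 + 2 * B) * real N = 2 * \<kappa> * (1 + 2 * B) * l"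
    unfolding l[symmetric] by (simp add: ac_simps)
  finally show ?thesis by (simp add: a_def ac_simps)
qed

end

section \<open>Convergence\<close>

lemma stepsize_tendsto_0: "(\<lambda>N. stepsize t0 T N) \<longlonglongrightarrow> 0"
  unfolding stepsize_def by (rule lim_const_over_n)

lemma eventually_stepsize_pos: "t0 < T \<Longrightarrow> \<forall>\<^sub>F N in sequentially. 0 < stepsize t0 T N"
  using eventually_gt_at_top[of 0] by eventually_elim (simp add: stepsize_def)

text \<open>The abscissae \<open>c\<^sub>i\<close> may exceed \<open>1\<close>, so the exact value functions reach beyond \<open>T\<close>, but
  only by \<open>O(h)\<close>.\<close>

lemma eventually_exact_Z_Cspace:
  fixes y :: "real \<Rightarrow> 'v::euclidean_space"
  assumes y: "continuous_on {t. ereal t < tbar} y" and T: "t0 < T" "ereal T < tbar"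
  shows "\<forall>\<^sub>F N in sequentially. \<forall>n\<le>N. \<forall>j\<in>{1..stages M + 2}. exact_Z M y t0 (stepsize t0 T N) n j \<in> Cspace r"
proof -
  obtain b where b: "ereal T < ereal b" "ereal b < tbar" using ereal_dense2[OF T(2)] by blast
  define m where "m = (\<Sum>j\<in>{1..stages M + 2}. \<bar>cx M j - 1\<bar>)"
  have "(\<lambda>N. T + m * stepsize t0 T N) \<longlonglongrightarrow> T + m * 0"
    by (intro tendsto_intros stepsize_tendsto_0)
  then have "\<forall>\<^sub>F N in sequentially. T + m * stepsize t0 T N < b"
    by (rule order_tendstoD) (use b in simp)
  with eventually_stepsize_pos[OF T(1)] show ?thesis
  proof eventually_elim
    case (elim N)
    define h where "h = stepsize t0 T N"
    show ?case
    proof (intro allI ballI impI)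
      fix n j assume n: "n \<le> N" and j: "j \<in> {1..stages M + 2}"
      have N: "0 < N" using elim(1) by (cases N) (auto simp: stepsize_def)
      have nh: "t0 + real n * h \<le> T"
      proof -
        have "real n * h \<le> real N * h" using n elim(1) by (intro mult_right_mono) (auto simp: h_def)
        also have "\<dots> = T - t0" using N by (simp add: h_def stepsize_def)
        finally show ?thesis by simp
      qed
      have "\<bar>cx M j - 1\<bar> \<le> m"
        unfolding m_def by (rule member_le_sum[where f = "\<lambda>j. \<bar>cx M j - 1\<bar>"]) (use j in auto)
      then have "(cx M j - 1) * h \<le> m * h" using elim(1) by (intro mult_right_mono) (auto simp: h_def)
      then have below: "t0 + real n * h + (cx M j - 1) * h \<le> b" using nh elim(2) by (simp add: h_def)
      have "continuous_on {-r..0} (\<lambda>\<omega>. y (t0 + real n * h + (cx M j - 1) * h + \<omega>))"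
      proof (rule continuous_on_compose2[OF y])
        show "(\<lambda>\<omega>. t0 + real n * h + (cx M j - 1) * h + \<omega>) ` {-r..0} \<subseteq> {t. ereal t < tbar}"
        proof clarify
          fix \<omega> assume "\<omega> \<in> {-r..0}"
          then have "ereal (t0 + real n * h + (cx M j - 1) * h + \<omega>) \<le> ereal b" using below by simp
          then show "ereal (t0 + real n * h + (cx M j - 1) * h + \<omega>) < tbar" using b(2) by (rule le_less_trans)
        qed
      qed (intro continuous_intros)
      then show "exact_Z M y t0 (stepsize t0 T N) n j \<in> Cspace r"
        by (cases "j = stages M + 2") (simp_all add: Cspace_def exact_Z_def[abs_def] h_def)
    qed
  qed
qed

lemma bigo_eventually_le:
  fixes f :: "nat \<Rightarrow> real"
  assumes "f \<in> O(\<lambda>N. h N ^ k)" "\<forall>\<^sub>F N in sequentially. 0 < h N"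
  obtains c where "0 < c" "\<forall>\<^sub>F N in sequentially. f N \<le> c * h N ^ k"
proof -
  obtain c where c: "0 < c" "\<forall>\<^sub>F N in sequentially. norm (f N) \<le> c * norm (h N ^ k)"
    using landau_o.bigE[OF assms(1)] by blast
  from assms(2) c(2) have "\<forall>\<^sub>F N in sequentially. f N \<le> c * h N ^ k"
    by eventually_elim (simp add: abs_le_iff)
  with c(1) show thesis by (rule that)
qed

theorem theorem2p7:
  fixes nrm :: "real ^ 'd \<Rightarrow> real"
    and r t0 T :: real and tbar :: ereal
    and f :: "real \<Rightarrow> (real \<Rightarrow> real ^ 'd) \<Rightarrow> real ^ 'd"
    and f' :: "real \<Rightarrow> (real \<Rightarrow> real ^ 'd) \<Rightarrow> (real \<Rightarrow> real ^ 'd) \<Rightarrow> real ^ 'd"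
    and \<phi>0 y :: "real \<Rightarrow> real ^ 'd"
    and M :: tsrk and p :: nat
    and S :: "real \<Rightarrow> real \<Rightarrow> (real \<Rightarrow> real ^ 'd) \<Rightarrow> nat \<Rightarrow> real \<Rightarrow> real ^ 'd"
    and z :: "nat \<Rightarrow> nat \<Rightarrow> nat \<Rightarrow> real \<Rightarrow> real ^ 'd"
  defines "h \<equiv> stepsize t0 T"
  defines "q \<equiv> (\<lambda>N. global_error M y t0 (h N) (z N))"
  defines "d \<equiv> (\<lambda>N. local_d M f y t0 (h N))"
  assumes nrm: "is_norm nrm" and r: "0 \<le> r" and p: "0 < p"
    and f: "continuous_rhs nrm r f"
    and f': "is_derivative_rhs nrm r f f'"
      "bounded_derivative nrm r f'" "continuous_derivative nrm r f'"
    and \<phi>0: "\<phi>0 \<in> Cspace r"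
    and y: "rfde_unique_noncontinuable f r t0 \<phi>0 y tbar"
    \<comment> \<open>outside \<open>[t0 - r, tbar)\<close>, \<open>y\<close> is the fixed continuous extension to the left\<close>
    and y_ext: "continuous_on {t. ereal t < tbar} y"
    and T: "t0 < T" "ereal T < tbar"
    and M: "valid_tsrk M"
    and start: "\<forall>\<^sub>F N in sequentially. z N 0 = S (h N) t0 \<phi>0 \<and> valid_start M r (z N 0)"
    and steps: "\<forall>\<^sub>F N in sequentially.
                  \<forall>n\<in>{1..N}. tsrk_step M r f t0 (h N) n (z N (n - 1)) (z N n)"
    and zero_stable: "zero_stable M"
    and q0_uniform: "(\<lambda>N. tnorm nrm M r (q N 0)) \<in> O(\<lambda>N. h N ^ (p - 1))"
    and q0_discrete: "(\<lambda>N. vnorm nrm M (\<lambda>j. q N 0 j 0)) \<in> O(\<lambda>N. h N ^ p)"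
    \<comment> \<open>accuracy of the starting approximation to the initial function (component \<open>s + 1\<close>);
        this holds trivially if the starting procedure takes over \<open>\<phi>0\<close> itself\<close>
    and q0_history: "(\<lambda>N. Cnorm nrm r (q N 0 (stages M + 1))) \<in> O(\<lambda>N. h N ^ p)"
    and d_uniform: "(\<lambda>N. MAX n\<in>{1..N}. tnorm nrm M r (d N n)) \<in> O(\<lambda>N. h N ^ (p - 1))"
    and d_discrete: "(\<lambda>N. MAX n\<in>{1..N-1}. vnorm nrm M (\<lambda>j. d N n j 0)) \<in> O(\<lambda>N. h N ^ p)"
  shows "(\<lambda>N. MAX n\<in>{1..N}. tnorm nrm M r (q N n)) \<in> O(\<lambda>N. h N ^ p)"
proof -
  let ?s = "stages M"
  obtain L where L: "0 \<le> L" "\<And>t \<phi> \<psi>. \<lbrakk>\<phi> \<in> Cspace r; \<psi> \<in> Cspace r\<rbrakk>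
      \<Longrightarrow> nrm (f t \<phi> - f t \<psi>) \<le> L * Cnorm nrm r (\<lambda>\<theta>. \<phi> \<theta> - \<psi> \<theta>)"
    using rhs_lipschitz[OF nrm r f'(1,2)] by blast
  obtain B where B: "1 \<le> B"
    "\<And>i j x. \<lbrakk>i \<in> {1..?s + 1}; j \<in> {1..?s}; x \<in> {- cx M i..0}\<rbrakk> \<Longrightarrow>
      \<bar>1 - ubar M i x\<bar> \<le> B \<and> \<bar>ubar M i x\<bar> \<le> B \<and> \<bar>atbar M i j x\<bar> \<le> B \<and> \<bar>abar M i j x\<bar> \<le> B"
    using coefficients_bounded[of M] by blast
  have h_pos: "\<forall>\<^sub>F N in sequentially. 0 < h N"
    unfolding h_def by (rule eventually_stepsize_pos[OF T(1)])
  obtain C1 where C1: "0 < C1" "\<forall>\<^sub>F N in sequentially. tnorm nrm M r (q N 0) \<le> C1 * h N ^ (p - 1)"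
    using bigo_eventually_le[OF q0_uniform h_pos] by blast
  obtain C2 where C2: "0 < C2" "\<forall>\<^sub>F N in sequentially. vnorm nrm M (\<lambda>j. q N 0 j 0) \<le> C2 * h N ^ p"
    using bigo_eventually_le[OF q0_discrete h_pos] by blast
  obtain C3 where C3: "0 < C3" "\<forall>\<^sub>F N in sequentially. Cnorm nrm r (q N 0 (?s + 1)) \<le> C3 * h N ^ p"
    using bigo_eventually_le[OF q0_history h_pos] by blast
  obtain C4 where C4: "0 < C4"
    "\<forall>\<^sub>F N in sequentially. (MAX n\<in>{1..N}. tnorm nrm M r (d N n)) \<le> C4 * h N ^ (p - 1)"
    using bigo_eventually_le[OF d_uniform h_pos] by blast
  obtain C5 where C5: "0 < C5"
    "\<forall>\<^sub>F N in sequentially. (MAX n\<in>{1..N-1}. vnorm nrm M (\<lambda>j. d N n j 0)) \<le> C5 * h N ^ p"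
    using bigo_eventually_le[OF d_discrete h_pos] by blast
  define C where "C = C1 + C2 + C3 + C4 + C5"
  have C: "0 \<le> C" "C1 \<le> C" "C2 \<le> C" "C3 \<le> C" "C4 \<le> C" "C5 \<le> C"
    using C1(1) C2(1) C3(1) C4(1) C5(1) by (simp_all add: C_def)
  define \<sigma> where "\<sigma> = real ?s * B * L"
  define K where "K = 2 / (2 - ubar M (?s + 1) 0)"
  define \<kappa> where "\<kappa> = \<sigma> * (1 + 2 * K)"
  define K' where "K' = 2 * (1 + 2 * B) * ((K * (3 + \<sigma> + (T - t0)) + 1 + \<sigma>) * C)
     * exp (2 * \<kappa> * (1 + 2 * B) * (T - t0))"
  have small: "\<forall>\<^sub>F N in sequentially. h N * \<kappa> * (1 + 2 * B) < 1 / 2"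
  proof (rule order_tendstoD)
    show "(\<lambda>N. h N * \<kappa> * (1 + 2 * B)) \<longlonglongrightarrow> 0 * \<kappa> * (1 + 2 * B)"
      unfolding h_def by (intro tendsto_intros stepsize_tendsto_0)
  qed simp
  have "\<forall>\<^sub>F N in sequentially. norm (MAX n\<in>{1..N}. tnorm nrm M r (q N n)) \<le> K' * norm (h N ^ p)"
    using h_pos C1(2) C2(2) C3(2) C4(2) C5(2) small start steps
      eventually_exact_Z_Cspace[OF y_ext T, of M r] eventually_gt_at_top[of 0]
  proof eventually_elim
    case (elim N)
    have hp: "h N * h N ^ (p - 1) = h N ^ p" using p by (simp flip: power_Suc)
    have hN: "real N * h N = T - t0" using \<open>0 < N\<close> by (simp add: h_def stepsize_def)
    have coarser: "c * h N ^ p \<le> C * h N ^ p" if "c \<le> C" for c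
      using that elim(1) by (intro mult_right_mono) auto
    have coarser': "h N * x \<le> C * h N ^ p" if "x \<le> c * h N ^ (p - 1)" "c \<le> C" for x c
    proof -
      have "h N * x \<le> h N * (c * h N ^ (p - 1))" using that(1) elim(1) by (intro mult_left_mono) auto
      also have "\<dots> = c * h N ^ p" unfolding hp[symmetric] by (simp add: ac_simps)
      finally show ?thesis using coarser[OF that(2)] by linarith
    qed
    interpret run: tsrk_run nrm r t0 "h N" L B f y M N "z N"
    proof unfold_locales
      show "tsrk_step M r f t0 (h N) n (z N (n - 1)) (z N n)" if "n \<in> {1..N}" for n
        using elim that by blast
      show "exact_Z M y t0 (h N) n j \<in> Cspace r" if "n \<le> N" "j \<in> {1..?s + 2}" for n j
        using elim that unfolding h_def by blast
    qed (use nrm r M L B elim in blast)+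
    have q_eq: "q N = run.q" and d_eq: "d N = run.d" by (simp_all add: q_def d_def)
    have bound: "tnorm nrm M r (q N n) \<le> K' * h N ^ p" if n: "n \<in> {1..N}" for n
      unfolding q_eq K'_def \<kappa>_def K_def \<sigma>_def run.\<sigma>_def[symmetric]
    proof (rule run.uniform_error[OF zero_stable _ C(1) hN _ _ _ _ _ _ n])
      show "0 \<le> h N ^ p" using elim(1) by simp
      show "Cnorm nrm r (run.q 0 (?s + 1)) \<le> C * h N ^ p"
        using elim(4) coarser[OF C(4)] by (simp add: q_eq)
      have "run.X 0 \<le> vnorm nrm M (\<lambda>j. q N 0 j 0)"
        unfolding run.X_def q_eq
        using le_vnorm[of "?s + 1" M nrm "\<lambda>j. run.q 0 j 0"] le_vnorm[of "?s + 2" M nrm "\<lambda>j. run.q 0 j 0"]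
        by simp
      then show "run.X 0 \<le> C * h N ^ p" using elim(3) coarser[OF C(3)] by linarith
      show "h N * run.Q 0 \<le> C * h N ^ p"
        using coarser'[OF elim(2) C(2)] by (simp add: q_eq)
      show "h N * (run.\<sigma> * (1 + 2 * (2 / (2 - ubar M (?s + 1) 0)))) * (1 + 2 * B) \<le> 1 / 2"
        using elim(7) by (simp add: \<kappa>_def \<sigma>_def K_def run.\<sigma>_def)
    next
      fix n assume n: "n \<in> {1..N}"
      have "run.D n \<le> (MAX n\<in>{1..N}. tnorm nrm M r (d N n))"
        unfolding d_eq by (rule Max_ge) (use n in auto)
      then show "h N * run.D n \<le> C * h N ^ p" using elim(5) C(5) by (intro coarser') auto
    next
      fix n assume n: "n \<in> {1..N - 1}"
      have "nrm (run.d n (?s + 1) 0) \<le> vnorm nrm M (\<lambda>j. d N n j 0)"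
        unfolding d_eq by (rule le_vnorm) simp
      also have "\<dots> \<le> (MAX n\<in>{1..N-1}. vnorm nrm M (\<lambda>j. d N n j 0))"
        by (rule Max_ge) (use n in auto)
      finally show "nrm (run.d n (?s + 1) 0) \<le> C * h N ^ p"
        using elim(6) coarser[OF C(6)] by linarith
    qed
    have "0 \<le> run.Q N" by (rule run.Q_nonneg) simp
    also have "\<dots> \<le> (MAX n\<in>{1..N}. tnorm nrm M r (q N n))"
      unfolding q_eq by (rule Max_ge) (use \<open>0 < N\<close> in auto)
    finally have "0 \<le> (MAX n\<in>{1..N}. tnorm nrm M r (q N n))" .
    moreover have "(MAX n\<in>{1..N}. tnorm nrm M r (q N n)) \<le> K' * h N ^ p"
      by (subst Max_le_iff) (use bound \<open>0 < N\<close> in auto)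
    ultimately show ?case using elim(1) by simp
  qed
  then show ?thesis by (rule bigoI)
qed

end
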